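(* Let $\bm F\in\mathbb R^{n\times m}$ with $\bm Q=\bm F\bm F^\top\succ\bm 0$, and let $Z=\{0,1\}^n$. Suppose that $G=\mathrm{supp}(\bm Q)$ or $G=\mathrm{supp}(\bm Q^{-1})$ has polynomial volume growth with parameters $\gamma,\delta>0$, and that the associated $\eta$-boundaries satisfy $\omega_G(\eta)\le\delta'\eta^{\gamma'}$ for all $\eta\ge1$, for some parameters $\gamma',\delta'>0$. Then, for every $\epsilon>0$, there exists an $\epsilon$-exact decision diagram for $X_{\bm F}$ with the number of nodes bounded by $$(n+1)\cdot2^{\delta'\eta_\epsilon^{\gamma'}},$$ where $\eta_\epsilon=\mathcal O(\log(1/\epsilon))$ with constants depending only on $\gamma$, $\delta$ and the extreme eigenvalues of $\bm Q$.
   Context: For a symmetric matrix $\bm M\in\mathbb R^{n\times n}$, $\mathrm{supp}(\bm M)$ is the simple graph on $[n]=\{1,\dots,n\}$ with an edge $(i,j)$, $i\neq j$, iff $M_{ij}\ne0$. For a graph $G$ on $[n]$, $d_G$ is the shortest-path distance, $\Delta_{G,\eta}=\max_{u\in[n]}|\{v\in[n]:d_G(u,v)\le\eta\}|$, and $G$ has polynomial volume growth with parameters $\gamma,\delta>0$ if $\Delta_{G,\eta}\le\delta\eta^\gamma$ for all $\eta\ge1$ ($\eta$ integer). For $\ell\in\{2,\dots,n\}$ and integer $\eta\ge1$, the $\eta$-boundary at layer $\ell$ is $\Lambda^\eta_{G,\ell}=\{j\in\{1,\dots,\ell-1\}:d_G(i,j)\le\eta\text{ for some }i\in\{\ell,\dots,n\}\}$,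 and $\omega_G(\eta)=\max_{2\le\ell\le n}|\Lambda^\eta_{G,\ell}|$. $X_{\bm F}=\{(x_0,\bm x,\bm z)\in\mathbb R\times\mathbb R^n\times\{0,1\}^n:\ \|\bm F^\top\bm x\|_2^2\le x_0,\ x_i(1-z_i)=0\ \forall i\}$. $\bm H_\downarrow$ is $\bm H$ with its first row deleted; $\|\bm H\|_{2,\infty}$ is the maximum Euclidean norm of the rows of $\bm H$. $\epsilon$-exact decision diagram (for $Z=\{0,1\}^n$, $\epsilon>0$): any layered diagram obtained by the following construction with tolerance $\epsilon$. Layer 1 has a single node storing the matrix $\bm F$. Given the nodes of layer $\ell\le n$, each storing a matrix in $\mathbb R^{(n+1-\ell)\times m}$, for every node (storing $\bm H$, with first row $\bm u^\top$) and every $\bar z\in\{0,1\}$ create a new node of layer $\ell+1$ and an arc to it with value $\bar z$. If $\bar z=1$ and $\|\bm u\|_2>\epsilon$, the arc has transition vector $\bm u_a=\bm u/\|\bm u\|_2$ and the new node stores $\bm H_\downarrow(\bm I-\bm u_a\bm u_a^\top)$; otherwise the arc has transition vector $\bm 0$ and the new node stores $\bm H_\downarrow$. Once all nodes of layer $\ell$ are processed, nodes of layer $\ell+1$ are merged: while two nodes of the layer storing $\bm H_1,\bm H_2$ are identified to satisfy $\|\bm H_1-\bm H_2\|_{2,\infty}\le\epsilon$, the second is deleted and all arcs pointing to it are redirected to the first (which keeps storing $\bm H_1$). Which pairs are identified depends on the implementation of the merging routine, so $\epsilon$-exact diagrams are not unique. After processing layer $n$ the stored matrices are empty and all remaining nodes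 are merged into a terminal node. *)

theory Defs
  imports
    "Jordan_Normal_Form.Spectral_Radius"
    "HOL-Library.Landau_Symbols"
    "HOL-Library.Extended_Nat"
begin

text \<open>
  Indices are 0-based throughout: the vertex set is \<open>{..<n}\<close> instead of \<open>{1..n}\<close>, and the layers of
  a diagram are numbered \<open>0..n\<close> instead of \<open>1..n+1\<close>.
\<close>


subsection \<open>Matrices\<close>

definition vnorm :: "real vec \<Rightarrow> real" where
  "vnorm u = sqrt (u \<bullet> u)"

text \<open>The maximum runs over \<open>0\<close> as well so that a matrix without rows has norm \<open>0\<close>.\<close>

definition norm_2_inf :: "real mat \<Rightarrow> real" where
  "norm_2_inf H = Max (insert 0 ((\<lambda>i. vnorm (row H i)) ` {..<dim_row H}))"

definition drop_first_row :: "'a mat \<Rightarrow> 'a mat" where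
  "drop_first_row H = mat (dim_row H - 1) (dim_col H) (\<lambda>(i, j). H $$ (Suc i, j))"

definition outer :: "real vec \<Rightarrow> real mat" where
  "outer u = mat (dim_vec u) (dim_vec u) (\<lambda>(i, j). u $ i * u $ j)"

definition positive_definite :: "real mat \<Rightarrow> bool" where
  "positive_definite A \<longleftrightarrow> square_mat A \<and> A\<^sup>T = A \<and>
     (\<forall>x\<in>carrier_vec (dim_row A). x \<noteq> 0\<^sub>v (dim_row A) \<longrightarrow> x \<bullet> (A *\<^sub>v x) > 0)"


subsection \<open>Graphs on \<open>{..<n}\<close>\<close>

text \<open>A simple graph is given by its edge relation, which is irreflexive and symmetric; for
  \<open>supp_graph\<close> the symmetry comes from that of the matrix.\<close>

definition supp_graph :: "real mat \<Rightarrow> (nat \<times> nat) set" where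
  "supp_graph M = {(i, j). i < dim_row M \<and> j < dim_row M \<and> i \<noteq> j \<and> M $$ (i, j) \<noteq> 0}"

text \<open>Least length of a walk; it is \<open>\<infinity>\<close> if there is none.\<close>

definition graph_dist :: "(nat \<times> nat) set \<Rightarrow> nat \<Rightarrow> nat \<Rightarrow> enat" where
  "graph_dist E u v = (INF k\<in>{k. (u, v) \<in> E ^^ k}. enat k)"

definition max_ball :: "nat \<Rightarrow> (nat \<times> nat) set \<Rightarrow> nat \<Rightarrow> nat" where
  "max_ball n E \<eta> = Max ((\<lambda>u. card {v \<in> {..<n}. graph_dist E u v \<le> enat \<eta>}) ` {..<n})"

definition poly_volume_growth :: "nat \<Rightarrow> (nat \<times> nat) set \<Rightarrow> real \<Rightarrow> real \<Rightarrow> bool" where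
  "poly_volume_growth n E \<gamma> \<delta> \<longleftrightarrow> (\<forall>\<eta>::nat. \<eta> \<ge> 1 \<longrightarrow> real (max_ball n E \<eta>) \<le> \<delta> * real \<eta> powr \<gamma>)"

text \<open>\<open>boundary n E \<eta> k\<close> is the boundary at the layer where the first \<open>k\<close> vertices have been
  processed, i.e. at the layer \<open>\<ell> = k + 1\<close> in 1-based numbering.\<close>

definition boundary :: "nat \<Rightarrow> (nat \<times> nat) set \<Rightarrow> nat \<Rightarrow> nat \<Rightarrow> nat set" where
  "boundary n E \<eta> k = {j \<in> {..<k}. \<exists>i\<in>{k..<n}. graph_dist E i j \<le> enat \<eta>}"

text \<open>The additional \<open>0\<close> only matters for \<open>n = 1\<close>, where no layer is left to range over.\<close>

definition max_boundary :: "nat \<Rightarrow> (nat \<times> nat) set \<Rightarrow> nat \<Rightarrow> nat" where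
  "max_boundary n E \<eta> = Max (insert 0 ((\<lambda>k. card (boundary n E \<eta> k)) ` {1..<n}))"


subsection \<open>Decision diagrams\<close>

text \<open>
  A node carries the matrix it stores and an identifier, namely the arc values along which it was
  created. The identifier keeps apart distinct nodes that store equal matrices.
\<close>

datatype node = Node (ident: "bool list") (stored: "real mat")

record arc =
  tail :: node
  arc_value :: bool
  transition :: "real vec"
  head :: node

text \<open>\<open>arcs D ! k\<close> holds the arcs from \<open>layers D ! k\<close> to \<open>layers D ! Suc k\<close>.\<close>

record diagram =
  layers :: "node set list"
  arcs :: "arc set list"

definition num_nodes :: "diagram \<Rightarrow> nat" where
  "num_nodes D = (\<Sum>V\<leftarrow>layers D. card V)"

definition projecting :: "real \<Rightarrow> bool \<Rightarrow> real mat \<Rightarrow> bool" where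
  "projecting \<epsilon> b H \<longleftrightarrow> b \<and> vnorm (row H 0) > \<epsilon>"

definition transition_vec :: "real \<Rightarrow> bool \<Rightarrow> real mat \<Rightarrow> real vec" where
  "transition_vec \<epsilon> b H =
     (if projecting \<epsilon> b H then (1 / vnorm (row H 0)) \<cdot>\<^sub>v row H 0 else 0\<^sub>v (dim_col H))"

definition child_mat :: "real \<Rightarrow> bool \<Rightarrow> real mat \<Rightarrow> real mat" where
  "child_mat \<epsilon> b H =
     (if projecting \<epsilon> b H
      then drop_first_row H * (1\<^sub>m (dim_col H) - outer (transition_vec \<epsilon> b H))
      else drop_first_row H)"

definition child :: "real \<Rightarrow> bool \<Rightarrow> node \<Rightarrow> node" where
  "child \<epsilon> b v = Node (ident v @ [b]) (child_mat \<epsilon> b (stored v))"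

definition out_arc :: "real \<Rightarrow> bool \<Rightarrow> node \<Rightarrow> arc" where
  "out_arc \<epsilon> b v =
     \<lparr>tail = v, arc_value = b, transition = transition_vec \<epsilon> b (stored v), head = child \<epsilon> b v\<rparr>"

definition children :: "real \<Rightarrow> node set \<Rightarrow> node set" where
  "children \<epsilon> V = {child \<epsilon> b v | b v. v \<in> V}"

definition out_arcs :: "real \<Rightarrow> node set \<Rightarrow> arc set" where
  "out_arcs \<epsilon> V = {out_arc \<epsilon> b v | b v. v \<in> V}"

definition redirect :: "node \<Rightarrow> node \<Rightarrow> arc \<Rightarrow> arc" where
  "redirect w v a = (if head a = w then a\<lparr>head := v\<rparr> else a)"

text \<open>One merge within a layer, acting on the nodes of the layer and the arcs entering it.\<close>

inductive merge :: "real \<Rightarrow> node set \<times> arc set \<Rightarrow> node set \<times> arc set \<Rightarrow> bool" for \<epsilon> where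
  "\<lbrakk>v \<in> V; w \<in> V; v \<noteq> w; norm_2_inf (stored v - stored w) \<le> \<epsilon>\<rbrakk>
    \<Longrightarrow> merge \<epsilon> (V, A) (V - {w}, redirect w v ` A)"

text \<open>
  The diagram for the set \<open>{(x0, x, z). \<parallel>F\<^sup>T x\<parallel>\<^sup>2 \<le> x0, x\<^sub>i (1 - z\<^sub>i) = 0, z \<in> {0,1}\<^sup>n}\<close> is built from the factor
  \<open>F\<close> alone, and \<open>F\<close> is not determined by that set, so \<open>F\<close> is the parameter.

  Which merges are performed is left open, as it depends on the merging routine. The last layer is
  the exception: its stored matrices have no rows, hence are at distance \<open>0\<close> from each other, and
  they are merged until only the terminal node is left.
\<close>

definition eps_exact_diagram :: "real mat \<Rightarrow> real \<Rightarrow> diagram \<Rightarrow> bool" where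
  "eps_exact_diagram F \<epsilon> D \<longleftrightarrow>
     length (layers D) = Suc (dim_row F) \<and> length (arcs D) = dim_row F \<and>
     layers D ! 0 = {Node [] F} \<and>
     (\<forall>k<dim_row F.
        (merge \<epsilon>)\<^sup>*\<^sup>* (children \<epsilon> (layers D ! k), out_arcs \<epsilon> (layers D ! k))
                 (layers D ! Suc k, arcs D ! k)) \<and>
     card (layers D ! dim_row F) = 1"

end

theory Submission
  imports Defs "HOL-Real_Asymp.Real_Asymp"
begin

text \<open>
  The matrix stored in a node of layer \<open>k\<close> depends only on the set \<open>P\<close> of rows that were projected
  out on the way to the node that survived the merges: its rows are the residuals of the remaining
  rows of \<open>F\<close> with respect to the span of the rows in \<open>P\<close>. In particular no merging error
  accumulates. The coefficients of such a residual decay exponentially in the graph distance, for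
  \<open>supp Q\<close> as well as for \<open>supp Q\<^sup>-\<^sup>1\<close>, because a Richardson iteration converges geometrically while
  its support grows by one neighbourhood per step. Hence two nodes whose sets \<open>P\<close> agree on the
  \<open>\<eta>\<close>-boundary store matrices at distance at most \<open>\<epsilon>\<close>, where \<open>\<eta> = O (log (1 / \<epsilon>))\<close>, and merging all
  such pairs leaves at most one node per subset of the boundary.
\<close>

subsection \<open>Quadratic forms of symmetric matrices\<close>

lemma transpose_symmetric_scalar:
  fixes A :: "real mat"
  assumes A: "A \<in> carrier_mat n n" "A\<^sup>T = A" and x: "x \<in> carrier_vec n" and y: "y \<in> carrier_vec n"
  shows "x \<bullet> (A *\<^sub>v y) = y \<bullet> (A *\<^sub>v x)"
proof -
  have "(A\<^sup>T *\<^sub>v x) \<bullet> y = x \<bullet> (A *\<^sub>v y)"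
    by (rule transpose_vec_mult_scalar[OF A(1) y x])
  then show ?thesis
    using A x y by (simp add: comm_scalar_prod[of "A *\<^sub>v x" n y])
qed

lemma quadratic_form_diff:
  fixes A :: "real mat"
  assumes A: "A \<in> carrier_mat n n" "A\<^sup>T = A" and x: "x \<in> carrier_vec n" and y: "y \<in> carrier_vec n"
  shows "(x - c \<cdot>\<^sub>v y) \<bullet> (A *\<^sub>v (x - c \<cdot>\<^sub>v y)) =
    x \<bullet> (A *\<^sub>v x) - 2 * c * (y \<bullet> (A *\<^sub>v x)) + c\<^sup>2 * (y \<bullet> (A *\<^sub>v y))"
proof -
  have "A *\<^sub>v (x - c \<cdot>\<^sub>v y) = A *\<^sub>v x - c \<cdot>\<^sub>v (A *\<^sub>v y)"
    using A x y by (simp add: mult_minus_distrib_mat_vec[of A n n] mult_mat_vec[of A n n])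
  then show ?thesis
    using A x y transpose_symmetric_scalar[OF A x y]
    by (simp add: minus_scalar_prod_distrib[of _ n] scalar_prod_minus_distrib[of _ n]
        power2_eq_square algebra_simps)
qed

lemma scalar_prod_self_diff:
  fixes x y :: "real vec"
  assumes "x \<in> carrier_vec n" "y \<in> carrier_vec n"
  shows "(x - c \<cdot>\<^sub>v y) \<bullet> (x - c \<cdot>\<^sub>v y) = x \<bullet> x - 2 * c * (y \<bullet> x) + c\<^sup>2 * (y \<bullet> y)"
  using quadratic_form_diff[of "1\<^sub>m n" n x y c] assms by simp

lemma scalar_prod_self_nonneg: "0 \<le> (x :: real vec) \<bullet> x"
  by (simp add: scalar_prod_def sum_nonneg)

lemma scalar_prod_self_pos:
  fixes x :: "real vec"
  assumes "x \<in> carrier_vec n" "x \<noteq> 0\<^sub>v n"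
  shows "0 < x \<bullet> x"
proof -
  obtain i where i: "i < n" "x $ i \<noteq> 0"
    using assms by (metis carrier_vecD eq_vecI index_zero_vec(1) index_zero_vec(2))
  have "x $ i * x $ i \<le> x \<bullet> x"
    unfolding scalar_prod_def using i assms by (intro member_le_sum) auto
  moreover have "0 < x $ i * x $ i"
    using i by (metis not_real_square_gt_zero)
  ultimately show ?thesis by linarith
qed

lemma scalar_prod_le_mean:
  fixes x y :: "real vec"
  assumes "x \<in> carrier_vec n" "y \<in> carrier_vec n"
  shows "2 * (y \<bullet> x) \<le> x \<bullet> x + y \<bullet> y"
  using scalar_prod_self_nonneg[of "x - 1 \<cdot>\<^sub>v y"] assms by (simp only: scalar_prod_self_diff) simp

lemma quadratic_form_sum:
  fixes A :: "real mat"
  assumes "A \<in> carrier_mat n n" "x \<in> carrier_vec n"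
  shows "x \<bullet> (A *\<^sub>v x) = (\<Sum>i<n. \<Sum>j<n. A $$ (i, j) * (x $ i * x $ j))"
  using assms by (simp add: scalar_prod_def atLeast0LessThan sum_distrib_left algebra_simps)

text \<open>The sum of the absolute values of the entries bounds the form crudely, and adding 1
  makes it positive. Only the existence of some constant matters: it is used before anything is
  known about the eigenvalues.\<close>

lemma quadratic_form_bounded:
  fixes A :: "real mat"
  assumes A: "A \<in> carrier_mat n n"
  obtains K where "K > 0" "\<And>x. x \<in> carrier_vec n \<Longrightarrow> \<bar>x \<bullet> (A *\<^sub>v x)\<bar> \<le> K * (x \<bullet> x)"
proof
  define K where "K = 1 + (\<Sum>i<n. \<Sum>j<n. \<bar>A $$ (i, j)\<bar>)"
  show "K > 0"
    unfolding K_def by (smt (verit) abs_ge_zero sum_nonneg)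
  fix x :: "real vec" assume x: "x \<in> carrier_vec n"
  have coord: "x $ i * x $ i \<le> x \<bullet> x" if "i < n" for i
    unfolding scalar_prod_def using that x by (intro member_le_sum) auto
  have coord2: "\<bar>x $ i * x $ j\<bar> \<le> x \<bullet> x" if "i < n" "j < n" for i j
  proof -
    have "0 \<le> (\<bar>x $ i\<bar> - \<bar>x $ j\<bar>)\<^sup>2" by simp
    then have "2 * \<bar>x $ i * x $ j\<bar> \<le> x $ i * x $ i + x $ j * x $ j"
      by (simp add: power2_diff abs_mult) (simp add: power2_eq_square)
    then show ?thesis using coord[OF that(1)] coord[OF that(2)] by linarith
  qed
  have "\<bar>x \<bullet> (A *\<^sub>v x)\<bar> \<le> (\<Sum>i<n. \<Sum>j<n. \<bar>A $$ (i, j)\<bar> * \<bar>x $ i * x $ j\<bar>)"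
    unfolding quadratic_form_sum[OF A x]
    by (rule order_trans[OF sum_abs] sum_mono)+ (simp add: abs_mult)
  also have "\<dots> \<le> (\<Sum>i<n. \<Sum>j<n. \<bar>A $$ (i, j)\<bar> * (x \<bullet> x))"
    by (intro sum_mono mult_left_mono coord2) auto
  also have "\<dots> = (K - 1) * (x \<bullet> x)"
    by (simp add: K_def sum_distrib_right)
  also have "\<dots> \<le> K * (x \<bullet> x)"
    using scalar_prod_self_nonneg[of x] by (simp add: algebra_simps)
  finally show "\<bar>x \<bullet> (A *\<^sub>v x)\<bar> \<le> K * (x \<bullet> x)" .
qed

text \<open>This is \<open>A^2 \<le> K A\<close> for \<open>0 \<le> A \<le> K\<close> in the order
  of quadratic forms. It follows from nonnegativity of the form at the point reached from
  \<open>x\<close> by a gradient step of length \<open>1 / K\<close>, without diagonalising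
  \<open>A\<close>.\<close>

lemma norm_mult_le_quadratic_form:
  fixes A :: "real mat"
  assumes A: "A \<in> carrier_mat n n" "A\<^sup>T = A"
    and nonneg: "\<And>x. x \<in> carrier_vec n \<Longrightarrow> 0 \<le> x \<bullet> (A *\<^sub>v x)"
    and le: "\<And>x. x \<in> carrier_vec n \<Longrightarrow> x \<bullet> (A *\<^sub>v x) \<le> K * (x \<bullet> x)"
    and K: "K > 0" and x: "x \<in> carrier_vec n"
  shows "(A *\<^sub>v x) \<bullet> (A *\<^sub>v x) \<le> K * (x \<bullet> (A *\<^sub>v x))"
proof -
  let ?y = "A *\<^sub>v x"
  have y: "?y \<in> carrier_vec n" by (rule mult_mat_vec_carrier[OF A(1) x])
  have "0 \<le> (x - (1 / K) \<cdot>\<^sub>v ?y) \<bullet> (A *\<^sub>v (x - (1 / K) \<cdot>\<^sub>v ?y))"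
    using x y by (intro nonneg) auto
  also have "\<dots> = x \<bullet> ?y - 2 * (1 / K) * (?y \<bullet> ?y) + (1 / K)\<^sup>2 * (?y \<bullet> (A *\<^sub>v ?y))"
    by (rule quadratic_form_diff[OF A x y])
  also have "\<dots> \<le> x \<bullet> ?y - 2 * (1 / K) * (?y \<bullet> ?y) + (1 / K)\<^sup>2 * (K * (?y \<bullet> ?y))"
    by (intro add_left_mono mult_left_mono le y) auto
  also have "\<dots> = x \<bullet> ?y - (?y \<bullet> ?y) / K"
    using K by (simp add: power2_eq_square field_simps)
  finally show ?thesis using K by (simp add: field_simps)
qed

text \<open>The best lower bound \<mu> of the Rayleigh quotient is an eigenvalue: if
  \<open>A - \<mu> I\<close> were invertible, its form would be bounded below by a positive multiple
  of \<open>x \<bullet> x\<close>, and \<mu> could be increased.\<close>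

lemma symmetric_min_eigenvalue:
  fixes A :: "real mat"
  assumes A: "A \<in> carrier_mat n n" "A\<^sup>T = A" and n: "n \<ge> 1"
  obtains \<mu> where "\<mu> \<in> spectrum A" "\<And>x. x \<in> carrier_vec n \<Longrightarrow> \<mu> * (x \<bullet> x) \<le> x \<bullet> (A *\<^sub>v x)"
proof -
  obtain K where K: "K > 0" "\<And>x. x \<in> carrier_vec n \<Longrightarrow> \<bar>x \<bullet> (A *\<^sub>v x)\<bar> \<le> K * (x \<bullet> x)"
    using quadratic_form_bounded[OF A(1)] by blast
  define L where "L = {c. \<forall>x\<in>carrier_vec n. c * (x \<bullet> x) \<le> x \<bullet> (A *\<^sub>v x)}"
  have "- K \<in> L"
    unfolding L_def using K(2) by (auto simp: abs_le_iff minus_le_iff)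
  have bdd: "c \<le> K" if "c \<in> L" for c
  proof -
    \<comment> \<open>Testing with one unit vector bounds \<open>L\<close> from above;
      \<open>n \<ge> 1\<close> provides this vector.\<close>
    let ?e = "unit_vec n 0 :: real vec"
    have e: "?e \<bullet> ?e = 1" "?e \<in> carrier_vec n" using n by auto
    then have "c * (?e \<bullet> ?e) \<le> ?e \<bullet> (A *\<^sub>v ?e)" using that unfolding L_def by blast
    with K(2)[of ?e] e show ?thesis by (metis abs_le_D1 mult.right_neutral order_trans)
  qed
  have bdd_above: "bdd_above L" by (intro bdd_aboveI) (rule bdd)
  define \<mu> where "\<mu> = Sup L"
  have low: "\<mu> * (x \<bullet> x) \<le> x \<bullet> (A *\<^sub>v x)" if x: "x \<in> carrier_vec n" for x
  proof (cases "x \<bullet> x = 0")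
    case True
    then show ?thesis using K(2)[OF x] by auto
  next
    case False
    then have pos: "x \<bullet> x > 0" using scalar_prod_self_nonneg[of x] by linarith
    have "\<mu> \<le> (x \<bullet> (A *\<^sub>v x)) / (x \<bullet> x)"
      unfolding \<mu>_def
    proof (intro cSup_least)
      show "L \<noteq> {}" using \<open>- K \<in> L\<close> by blast
    qed (use x pos in \<open>auto simp: L_def pos_le_divide_eq\<close>)
    then show ?thesis using pos by (simp add: pos_le_divide_eq)
  qed
  \<comment> \<open>\<open>char_matrix A \<mu>\<close> is \<open>A - \<mu> I\<close>, whose form is
    nonnegative by the choice of \<mu>.\<close>
  define M where "M = char_matrix A \<mu>"
  have M: "M \<in> carrier_mat n n" "M\<^sup>T = M"
    unfolding M_def char_matrix_def using A by (auto simp: transpose_add)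
  have Mx: "x \<bullet> (M *\<^sub>v x) = x \<bullet> (A *\<^sub>v x) - \<mu> * (x \<bullet> x)" if "x \<in> carrier_vec n" for x
  proof -
    have "(- \<mu> \<cdot>\<^sub>m 1\<^sub>m n) *\<^sub>v x = - \<mu> \<cdot>\<^sub>v x"
      using that by (intro eq_vecI) auto
    then have "M *\<^sub>v x = A *\<^sub>v x + - \<mu> \<cdot>\<^sub>v x"
      using that A unfolding M_def char_matrix_def by (simp add: add_mult_distrib_mat_vec[of _ n n])
    then show ?thesis
      using that A by (simp add: scalar_prod_add_distrib[of _ n])
  qed
  have "det M = 0"
  proof (rule ccontr)
    assume "det M \<noteq> 0"
    from det_non_zero_imp_unit[OF M(1) this, unfolded Units_def, of "()"]
    obtain N where N: "N \<in> carrier_mat n n" and NM: "N * M = 1\<^sub>m n"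
      by (auto simp: ring_mat_def)
    have "N\<^sup>T * N \<in> carrier_mat n n" using N by auto
    then obtain C where C: "C > 0" "\<And>x. x \<in> carrier_vec n \<Longrightarrow> \<bar>x \<bullet> ((N\<^sup>T * N) *\<^sub>v x)\<bar> \<le> C * (x \<bullet> x)"
      using quadratic_form_bounded by blast
    obtain K' where K': "K' > 0" "\<And>x. x \<in> carrier_vec n \<Longrightarrow> \<bar>x \<bullet> (M *\<^sub>v x)\<bar> \<le> K' * (x \<bullet> x)"
      using quadratic_form_bounded[OF M(1)] by blast
    \<comment> \<open>With \<open>y = M x\<close> and \<open>N M = 1\<close>,
      \<open>x \<bullet> x\<close> is the squared norm of \<open>N y\<close>, hence at most
      \<open>C (y \<bullet> y)\<close>, and \<open>y \<bullet> y\<close> is at most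
      \<open>K'\<close> times the form of \<open>M\<close> at \<open>x\<close>. The form of
      \<open>M\<close> thus exceeds \<open>x \<bullet> x / (C K')\<close>, up to equality, which is
      the room to increase \<mu>.\<close>
    have "\<mu> + 1 / (C * K') \<in> L"
      unfolding L_def
    proof (safe)
      fix x :: "real vec" assume x: "x \<in> carrier_vec n"
      let ?y = "M *\<^sub>v x"
      have y: "?y \<in> carrier_vec n" by (rule mult_mat_vec_carrier[OF M(1) x])
      have Ny: "N *\<^sub>v ?y = x"
        using NM x assoc_mult_mat_vec[OF N M(1) x] by simp
      have NTx: "N\<^sup>T *\<^sub>v x \<in> carrier_vec n" using N x by auto
      have "(N\<^sup>T * N) *\<^sub>v ?y = N\<^sup>T *\<^sub>v (N *\<^sub>v ?y)"
        using N y by (intro assoc_mult_mat_vec) auto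
      then have "?y \<bullet> ((N\<^sup>T * N) *\<^sub>v ?y) = (N\<^sup>T *\<^sub>v x) \<bullet> ?y"
        unfolding Ny using comm_scalar_prod[OF y NTx] by simp
      also have "\<dots> = x \<bullet> x"
        using transpose_vec_mult_scalar[OF N y x] unfolding Ny .
      finally have "x \<bullet> x = ?y \<bullet> ((N\<^sup>T * N) *\<^sub>v ?y)" ..
      also have "\<dots> \<le> C * (?y \<bullet> ?y)" using C(2)[OF y] by (simp add: abs_le_iff)
      also have "\<dots> \<le> C * (K' * (x \<bullet> ?y))"
        using C(1) K' low Mx
        by (intro mult_left_mono norm_mult_le_quadratic_form[OF M _ _ _ x]) (auto simp: abs_le_iff)
      finally have "x \<bullet> x / (C * K') \<le> x \<bullet> ?y"
        using C(1) K'(1) by (simp add: field_simps)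
      then show "(\<mu> + 1 / (C * K')) * (x \<bullet> x) \<le> x \<bullet> (A *\<^sub>v x)"
        using Mx[OF x] by (simp add: algebra_simps)
    qed
    then have "\<mu> + 1 / (C * K') \<le> \<mu>"
      unfolding \<mu>_def by (intro cSup_upper bdd_above)
    then show False using C(1) K'(1) by (simp add: field_simps)
  qed
  then have "\<mu> \<in> spectrum A"
    unfolding spectrum_def M_def using eigenvalue_det[OF A(1)] by simp
  with low that show thesis by blast
qed

lemma spectrum_uminus:
  fixes A :: "real mat"
  assumes A: "A \<in> carrier_mat n n" and k: "k \<in> spectrum (- A)"
  shows "- k \<in> spectrum A"
proof -
  obtain v where v: "v \<in> carrier_vec n" "v \<noteq> 0\<^sub>v n" "- A *\<^sub>v v = k \<cdot>\<^sub>v v"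
    using A k unfolding spectrum_def eigenvalue_def eigenvector_def by auto
  have "- (A *\<^sub>v v) = k \<cdot>\<^sub>v v"
    using A v by auto
  then have "A *\<^sub>v v = - (k \<cdot>\<^sub>v v)"
    by (metis uminus_uminus_vec)
  also have "\<dots> = - k \<cdot>\<^sub>v v"
    using v by (intro eq_vecI) auto
  finally have "A *\<^sub>v v = - k \<cdot>\<^sub>v v" .
  then show ?thesis
    using A v unfolding spectrum_def eigenvalue_def eigenvector_def by auto
qed

lemma rayleigh_bounds:
  fixes A :: "real mat"
  assumes A: "A \<in> carrier_mat n n" "A\<^sup>T = A" and n: "n \<ge> 1" and x: "x \<in> carrier_vec n"
  shows "Min (spectrum A) * (x \<bullet> x) \<le> x \<bullet> (A *\<^sub>v x)" "x \<bullet> (A *\<^sub>v x) \<le> Max (spectrum A) * (x \<bullet> x)"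
    "Min (spectrum A) \<in> spectrum A" "Min (spectrum A) \<le> Max (spectrum A)"
proof -
  have fin: "finite (spectrum A)" using card_finite_spectrum[OF A(1)] by simp
  obtain \<mu> where \<mu>: "\<mu> \<in> spectrum A" "\<mu> * (x \<bullet> x) \<le> x \<bullet> (A *\<^sub>v x)"
    using symmetric_min_eigenvalue[OF A n] x by blast
  \<comment> \<open>The upper bound is the lower bound for \<open>- A\<close> with the sign
    reversed.\<close>
  have "- A \<in> carrier_mat n n" "(- A)\<^sup>T = - A" using A by (auto simp: transpose_uminus)
  then obtain \<nu> where \<nu>: "\<nu> \<in> spectrum (- A)" "\<nu> * (x \<bullet> x) \<le> x \<bullet> (- A *\<^sub>v x)"
    using symmetric_min_eigenvalue[of "- A" n] n x by blast
  have \<nu>': "- \<nu> \<in> spectrum A" by (rule spectrum_uminus[OF A(1) \<nu>(1)])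
  have "Min (spectrum A) * (x \<bullet> x) \<le> \<mu> * (x \<bullet> x)"
    using fin \<mu> scalar_prod_self_nonneg by (intro mult_right_mono) auto
  with \<mu> show "Min (spectrum A) * (x \<bullet> x) \<le> x \<bullet> (A *\<^sub>v x)" by linarith
  have "- \<nu> * (x \<bullet> x) \<le> Max (spectrum A) * (x \<bullet> x)"
    using fin \<nu>' scalar_prod_self_nonneg by (intro mult_right_mono) auto
  moreover have "x \<bullet> (- A *\<^sub>v x) = - (x \<bullet> (A *\<^sub>v x))"
    using A x by auto
  ultimately show "x \<bullet> (A *\<^sub>v x) \<le> Max (spectrum A) * (x \<bullet> x)" using \<nu>(2) by simp
  show "Min (spectrum A) \<in> spectrum A" "Min (spectrum A) \<le> Max (spectrum A)"
    using fin \<mu>(1) by (auto intro: Min_in Min.coboundedI order_trans)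
qed

subsection \<open>Decay of residuals\<close>

text \<open>Entries off \<open>S\<close> are zeroed and the dimension is kept, so that principal
  blocks can be handled with the full matrix and no reindexing.\<close>

definition restrict_vec :: "nat set \<Rightarrow> real vec \<Rightarrow> real vec" where
  "restrict_vec S v = vec (dim_vec v) (\<lambda>a. if a \<in> S then v $ a else 0)"

lemma restrict_vec_carrier [simp]: "v \<in> carrier_vec n \<Longrightarrow> restrict_vec S v \<in> carrier_vec n"
  by (auto simp: restrict_vec_def)

lemma restrict_vec_index [simp]:
  "v \<in> carrier_vec n \<Longrightarrow> a < n \<Longrightarrow> restrict_vec S v $ a = (if a \<in> S then v $ a else 0)"
  by (auto simp: restrict_vec_def)

lemma scalar_prod_restrict_vec_le: "restrict_vec S v \<bullet> restrict_vec S v \<le> v \<bullet> v"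
  unfolding scalar_prod_def by (auto simp: restrict_vec_def intro!: sum_mono)

lemma scalar_prod_restrict_vec:
  assumes "v \<in> carrier_vec n" "w \<in> carrier_vec n" "\<And>a. a < n \<Longrightarrow> a \<notin> S \<Longrightarrow> w $ a = 0"
  shows "restrict_vec S v \<bullet> w = v \<bullet> w"
  unfolding scalar_prod_def using assms by (intro sum.cong) auto

lemma scalar_prod_disjoint_support:
  fixes x y :: "real vec"
  assumes "y \<in> carrier_vec n" "\<And>a. a < n \<Longrightarrow> x $ a = 0 \<or> y $ a = 0"
  shows "x \<bullet> y = 0"
  unfolding scalar_prod_def using assms by (intro sum.neutral) auto

section \<open>Graph distance and the growth of supports under multiplication\<close>

lemma graph_dist_le_iff: "graph_dist E u v \<le> enat t \<longleftrightarrow> (\<exists>k\<le>t. (u, v) \<in> E ^^ k)"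
proof
  assume le: "graph_dist E u v \<le> enat t"
  let ?K = "enat ` {k. (u, v) \<in> E ^^ k}"
  \<comment> \<open>An infimum over no walks would be \<infinity>; over a nonempty set of
    \<open>enat\<close> values it is attained, which yields an actual walk.\<close>
  have "?K \<noteq> {}"
  proof
    assume "?K = {}"
    then have "graph_dist E u v = \<infinity>" unfolding graph_dist_def by (simp add: top_enat_def)
    with le show False by simp
  qed
  then have "Inf ?K \<in> ?K"
    unfolding Inf_enat_def by (auto intro: LeastI)
  with le show "\<exists>k\<le>t. (u, v) \<in> E ^^ k"
    unfolding graph_dist_def by auto
next
  assume "\<exists>k\<le>t. (u, v) \<in> E ^^ k"
  then show "graph_dist E u v \<le> enat t"
    unfolding graph_dist_def by (auto intro: INF_lower2)
qed

lemma graph_dist_self: "graph_dist E u u \<le> enat t"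
  unfolding graph_dist_le_iff by (auto intro: exI[of _ 0])

lemma graph_dist_edge:
  assumes "graph_dist E u v \<le> enat t" "(v, w) \<in> E"
  shows "graph_dist E u w \<le> enat (Suc t)"
  using assms unfolding graph_dist_le_iff by (metis Suc_le_mono relpow_Suc_I)

lemma graph_dist_mono: "graph_dist E u v \<le> enat s \<Longrightarrow> s \<le> t \<Longrightarrow> graph_dist E u v \<le> enat t"
  by (meson enat_ord_simps(1) order_trans)

text \<open>A nonzero entry of \<open>M w\<close> at \<open>a\<close> needs some \<open>b\<close> in
  the support of \<open>w\<close> with a nonzero entry of \<open>M\<close> at \<open>(a, b)\<close>,
  so \<open>a\<close> equals \<open>b\<close> or is adjacent to it. Diagonal entries therefore do
  not enlarge the support.\<close>

lemma mult_mat_vec_support: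
  assumes M: "M \<in> carrier_mat n n" "M\<^sup>T = M" and w: "w \<in> carrier_vec n"
    and supp: "\<And>b. b < n \<Longrightarrow> w $ b \<noteq> 0 \<Longrightarrow> graph_dist (supp_graph M) i b \<le> enat t"
    and a: "a < n" "(M *\<^sub>v w) $ a \<noteq> 0"
  shows "graph_dist (supp_graph M) i a \<le> enat (Suc t)"
proof -
  have "(M *\<^sub>v w) $ a = (\<Sum>b<n. M $$ (a, b) * w $ b)"
    using M w a by (simp add: scalar_prod_def atLeast0LessThan)
  with a obtain b where b: "b < n" "M $$ (a, b) * w $ b \<noteq> 0"
    by (metis (no_types, lifting) lessThan_iff sum.neutral)
  have dist: "graph_dist (supp_graph M) i b \<le> enat t"
    using b supp by auto
  show ?thesis
  proof (cases "a = b")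
    case True
    then show ?thesis using graph_dist_mono[OF dist] by simp
  next
    case False
    have "M $$ (b, a) = M $$ (a, b)"
      using M a b by (metis carrier_matD(1) carrier_matD(2) index_transpose_mat(1))
    then have "(b, a) \<in> supp_graph M"
      using M a b False unfolding supp_graph_def by auto
    then show ?thesis by (rule graph_dist_edge[OF dist])
  qed
qed

text \<open>The two-sided bound \<open>lo I \<le> M \<le> hi I\<close> in the order of quadratic
  forms; the ratio \<open>hi / lo\<close> bounds the condition number and governs the rate of
  decay.\<close>

definition form_bounds :: "nat \<Rightarrow> real mat \<Rightarrow> real \<Rightarrow> real \<Rightarrow> bool" where
  "form_bounds n M lo hi \<longleftrightarrow> M \<in> carrier_mat n n \<and> M\<^sup>T = M \<and> 0 < lo \<and> lo \<le> hi \<and>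
     (\<forall>x\<in>carrier_vec n. lo * (x \<bullet> x) \<le> x \<bullet> (M *\<^sub>v x) \<and> x \<bullet> (M *\<^sub>v x) \<le> hi * (x \<bullet> x))"

lemma form_boundsD:
  assumes "form_bounds n M lo hi"
  shows "M \<in> carrier_mat n n" "M\<^sup>T = M" "0 < lo" "0 < hi" "lo \<le> hi"
    and "x \<in> carrier_vec n \<Longrightarrow> lo * (x \<bullet> x) \<le> x \<bullet> (M *\<^sub>v x)"
    and "x \<in> carrier_vec n \<Longrightarrow> x \<bullet> (M *\<^sub>v x) \<le> hi * (x \<bullet> x)"
    and "x \<in> carrier_vec n \<Longrightarrow> 0 \<le> x \<bullet> (M *\<^sub>v x)"
    and "x \<in> carrier_vec n \<Longrightarrow> (M *\<^sub>v x) \<bullet> (M *\<^sub>v x) \<le> hi * (x \<bullet> (M *\<^sub>v x))"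
proof -
  note defs = assms[unfolded form_bounds_def]
  show *: "M \<in> carrier_mat n n" "M\<^sup>T = M" "0 < lo" "0 < hi" "lo \<le> hi" using defs by auto
  show low: "lo * (x \<bullet> x) \<le> x \<bullet> (M *\<^sub>v x)" and upp: "x \<bullet> (M *\<^sub>v x) \<le> hi * (x \<bullet> x)"
    if "x \<in> carrier_vec n" for x
    using defs that by auto
  show nonneg: "0 \<le> x \<bullet> (M *\<^sub>v x)" if "x \<in> carrier_vec n" for x
    using low[OF that] scalar_prod_self_nonneg[of x] \<open>0 < lo\<close> by (meson mult_nonneg_nonneg less_imp_le order_trans)
  show "(M *\<^sub>v x) \<bullet> (M *\<^sub>v x) \<le> hi * (x \<bullet> (M *\<^sub>v x))" if "x \<in> carrier_vec n" for x
    by (rule norm_mult_le_quadratic_form[OF *(1,2) nonneg upp *(4) that])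
qed

text \<open>Substitute \<open>w = Q x\<close>. The lower bound is then
  \<open>Q^2 \<le> hi Q\<close>, and the upper bound follows from nonnegativity of the squared norm
  of \<open>w - lo x\<close>.\<close>

lemma form_bounds_inverse:
  assumes Q: "form_bounds n Q lo hi" and R: "R \<in> carrier_mat n n" "Q * R = 1\<^sub>m n" "R * Q = 1\<^sub>m n"
  shows "form_bounds n R (1 / hi) (1 / lo)"
proof -
  note Qb = form_boundsD[OF Q]
  have "R\<^sup>T * Q = 1\<^sub>m n"
    using Qb R transpose_mult[of Q n n R n] by simp
  then have sym: "R\<^sup>T = R"
    using Qb R by (metis assoc_mult_mat left_mult_one_mat right_mult_one_mat transpose_carrier_mat)
  have "1 / hi * (w \<bullet> w) \<le> w \<bullet> (R *\<^sub>v w) \<and> w \<bullet> (R *\<^sub>v w) \<le> 1 / lo * (w \<bullet> w)"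
    if w: "w \<in> carrier_vec n" for w
  proof -
    define x where "x = R *\<^sub>v w"
    have x: "x \<in> carrier_vec n" using R w x_def by auto
    have Qx: "Q *\<^sub>v x = w"
      unfolding x_def using Qb(1) R w by (metis assoc_mult_mat_vec one_mult_mat_vec)
    have comm: "x \<bullet> w = w \<bullet> x" using x w by (rule comm_scalar_prod)
    have low: "w \<bullet> w \<le> hi * (w \<bullet> x)" using Qb(9)[OF x] Qx comm by simp
    have "0 \<le> (w - lo \<cdot>\<^sub>v x) \<bullet> (w - lo \<cdot>\<^sub>v x)" by (rule scalar_prod_self_nonneg)
    also have "\<dots> = w \<bullet> w - 2 * lo * (w \<bullet> x) + lo * (lo * (x \<bullet> x))"
      using scalar_prod_self_diff[OF w x] comm by (simp add: power2_eq_square)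
    also have "\<dots> \<le> w \<bullet> w - 2 * lo * (w \<bullet> x) + lo * (w \<bullet> x)"
      using Qb(6)[OF x] Qb(3) Qx comm by (intro add_left_mono mult_left_mono) auto
    finally show ?thesis
      using low Qb(3,4) unfolding x_def[symmetric] by (simp add: field_simps)
  qed
  then show ?thesis
    using R sym Qb(3-5) unfolding form_bounds_def by (auto simp: frac_le)
qed

text \<open>Richardson iteration on the principal block \<open>S\<close>: every step contracts the error by the
  factor \<open>1 - lo / hi\<close> and enlarges the support by one graph neighbourhood.\<close>

lemma richardson_approximation:
  assumes M: "form_bounds n M lo hi" and w: "w \<in> carrier_vec n"
    and w_supp: "\<And>a. a < n \<Longrightarrow> a \<notin> S \<Longrightarrow> w $ a = 0"
    and rhs_supp: "\<And>a. a < n \<Longrightarrow> a \<in> S \<Longrightarrow> (M *\<^sub>v w) $ a \<noteq> 0 \<Longrightarrow> graph_dist (supp_graph M) i a \<le> enat 1"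
  shows "\<exists>w'\<in>carrier_vec n.
    (\<forall>a<n. w' $ a \<noteq> 0 \<longrightarrow> a \<in> S \<and> graph_dist (supp_graph M) i a \<le> enat t) \<and>
    (w - w') \<bullet> (w - w') \<le> (1 - lo / hi) ^ t * (w \<bullet> w)"
proof (induction t)
  case 0
  show ?case using w by (intro bexI[of _ "0\<^sub>v n"]) auto
next
  case (Suc t)
  note Mb = form_boundsD[OF M]
  obtain w' where w': "w' \<in> carrier_vec n"
    and supp: "\<And>a. a < n \<Longrightarrow> w' $ a \<noteq> 0 \<Longrightarrow> a \<in> S \<and> graph_dist (supp_graph M) i a \<le> enat t"
    and err: "(w - w') \<bullet> (w - w') \<le> (1 - lo / hi) ^ t * (w \<bullet> w)"
    using Suc by blast
  define d where "d = w - w'"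
  have d: "d \<in> carrier_vec n" unfolding d_def using w w' by auto
  \<comment> \<open>Restricting the residual to \<open>S\<close> keeps the iterates supported in
    \<open>S\<close>; the step length below is \<open>1 / hi\<close>.\<close>
  define r where "r = restrict_vec S (M *\<^sub>v d)"
  have Md: "M *\<^sub>v d \<in> carrier_vec n" by (rule mult_mat_vec_carrier[OF Mb(1) d])
  have r: "r \<in> carrier_vec n" unfolding r_def using Md by simp
  define w'' where "w'' = w' + (1 / hi) \<cdot>\<^sub>v r"
  have w'': "w'' \<in> carrier_vec n" unfolding w''_def using w' r by auto
  have Mdiff: "(M *\<^sub>v d) $ a = (M *\<^sub>v w) $ a - (M *\<^sub>v w') $ a" if "a < n" for a
    unfolding d_def using Mb(1) w w' that by (simp add: mult_minus_distrib_mat_vec[of M n n])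
  have "a \<in> S \<and> graph_dist (supp_graph M) i a \<le> enat (Suc t)" if a: "a < n" "w'' $ a \<noteq> 0" for a
  proof (cases "w' $ a = 0")
    case False
    then show ?thesis using supp[OF a(1)] graph_dist_mono[of _ _ _ t "Suc t"] by auto
  next
    case True
    then have "r $ a \<noteq> 0" using a r w' unfolding w''_def by auto
    then have aS: "a \<in> S" and "(M *\<^sub>v d) $ a \<noteq> 0"
      using a Md unfolding r_def by (auto split: if_splits)
    \<comment> \<open>A new support point comes either from the right-hand side, within distance 1
      of \<open>i\<close>, or from \<open>M w'\<close>, one step beyond the old support.\<close>
    then consider "(M *\<^sub>v w) $ a \<noteq> 0" | "(M *\<^sub>v w') $ a \<noteq> 0" using Mdiff[OF a(1)] by fastforce
    then have "graph_dist (supp_graph M) i a \<le> enat (Suc t)"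
    proof cases
      case 1
      then show ?thesis using graph_dist_mono[OF rhs_supp[OF a(1) aS]] by auto
    next
      case 2
      show ?thesis by (rule mult_mat_vec_support[OF Mb(1,2) w' _ a(1) 2]) (use supp in auto)
    qed
    with aS show ?thesis by simp
  qed
  moreover have "(w - w'') \<bullet> (w - w'') \<le> (1 - lo / hi) ^ Suc t * (w \<bullet> w)"
  proof -
    have eq: "w - w'' = d - (1 / hi) \<cdot>\<^sub>v r"
      unfolding d_def w''_def using w w' r by (intro eq_vecI) auto
    \<comment> \<open>The error \<open>d\<close> vanishes off \<open>S\<close>, so the restriction
      does not affect the product with \<open>d\<close>.\<close>
    have rd: "r \<bullet> d = d \<bullet> (M *\<^sub>v d)"
    proof -
      have "d $ a = 0" if "a < n" "a \<notin> S" for a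
        using that w_supp supp w w' unfolding d_def by auto
      then have "r \<bullet> d = (M *\<^sub>v d) \<bullet> d"
        unfolding r_def by (intro scalar_prod_restrict_vec[OF Md d])
      also have "\<dots> = d \<bullet> (M *\<^sub>v d)" using comm_scalar_prod[OF Md d] .
      finally show ?thesis .
    qed
    have rr: "r \<bullet> r \<le> hi * (d \<bullet> (M *\<^sub>v d))"
      using scalar_prod_restrict_vec_le[of S "M *\<^sub>v d"] Mb(9)[OF d] unfolding r_def by linarith
    have "(w - w'') \<bullet> (w - w'') = d \<bullet> d - 2 * (1 / hi) * (d \<bullet> (M *\<^sub>v d)) + (1 / hi)\<^sup>2 * (r \<bullet> r)"
      unfolding eq scalar_prod_self_diff[OF d r] rd ..
    also have "\<dots> \<le> d \<bullet> d - 2 * (1 / hi) * (d \<bullet> (M *\<^sub>v d)) + (1 / hi)\<^sup>2 * (hi * (d \<bullet> (M *\<^sub>v d)))"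
      by (intro add_left_mono mult_left_mono rr) auto
    also have "\<dots> = d \<bullet> d - (d \<bullet> (M *\<^sub>v d)) / hi"
      using Mb(4) by (simp add: power2_eq_square field_simps)
    also have "\<dots> \<le> d \<bullet> d - (lo * (d \<bullet> d)) / hi"
      using Mb(4) Mb(6)[OF d] by (intro diff_left_mono divide_right_mono) auto
    also have "\<dots> = (1 - lo / hi) * (d \<bullet> d)" by (simp add: algebra_simps)
    also have "\<dots> \<le> (1 - lo / hi) * ((1 - lo / hi) ^ t * (w \<bullet> w))"
      using err Mb(4,5) unfolding d_def by (intro mult_left_mono) auto
    finally show ?thesis by (simp add: mult.assoc)
  qed
  ultimately show ?case using w'' by blast
qed

text \<open>With \<open>h = F\<^sup>T x\<close> and \<open>Q = F F\<^sup>T\<close>, the assumptions on \<open>x\<close> say that \<open>h\<close> is the \<open>i\<close>-th row of \<open>F\<close>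
  minus its orthogonal projection onto the rows indexed by \<open>P\<close>. If \<open>Q\<close> is sparse, the iteration is
  applied to the normal equations on \<open>P\<close>; if \<open>Q\<^sup>-\<^sup>1\<close> is sparse, to \<open>w = Q x\<close>, which vanishes on \<open>P\<close>
  and satisfies \<open>Q\<^sup>-\<^sup>1 w = e\<^sub>i\<close> off \<open>P\<close>.\<close>

lemma residual_local_approximation:
  assumes Q: "form_bounds n Q lo hi" and R: "R \<in> carrier_mat n n" "Q * R = 1\<^sub>m n" "R * Q = 1\<^sub>m n"
    and G: "G = supp_graph Q \<or> G = supp_graph R"
    and i: "i < n" "i \<notin> P" and x: "x \<in> carrier_vec n" "x $ i = 1"
    and x_supp: "\<And>a. a < n \<Longrightarrow> x $ a \<noteq> 0 \<Longrightarrow> a = i \<or> a \<in> P"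
    and orth: "\<And>a. a < n \<Longrightarrow> a \<in> P \<Longrightarrow> (Q *\<^sub>v x) $ a = 0"
  obtains v where "v \<in> carrier_vec n" "v $ i = 1"
    "\<And>a. a < n \<Longrightarrow> v $ a \<noteq> 0 \<Longrightarrow> a = i \<or> a \<in> P \<and> graph_dist G i a \<le> enat (Suc t)"
    "(x - v) \<bullet> (Q *\<^sub>v (x - v)) \<le> hi ^ 3 / lo\<^sup>2 * (1 - lo / hi) ^ t"
proof -
  note Qb = form_boundsD[OF Q]
  let ?e = "unit_vec n i :: real vec"
  have Qx: "Q *\<^sub>v x \<in> carrier_vec n" by (rule mult_mat_vec_carrier[OF Qb(1) x(1)])
  have e_bound: "?e \<bullet> (Q *\<^sub>v ?e) \<le> hi"
    using Qb(7)[of ?e] i by simp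
  define u where "u = x - ?e"
  have u: "u \<in> carrier_vec n" unfolding u_def using x by auto
  have u_supp: "u $ a = 0" if "a < n" "a \<notin> P" for a
    using that x x_supp i unfolding u_def by (cases "a = i") auto
  \<comment> \<open>Pythagoras in the energy form of \<open>Q\<close>: \<open>u\<close> lives on
    \<open>P\<close>, where \<open>Q x\<close> vanishes. The energies of \<open>x\<close> and
    \<open>u\<close> add up to that of the unit vector, so both are at most
    \<open>hi\<close>.\<close>
  have "u \<bullet> (Q *\<^sub>v x) = 0"
    by (rule scalar_prod_disjoint_support[OF Qx]) (use u_supp orth in auto)
  moreover have "x - 1 \<cdot>\<^sub>v u = ?e"
    unfolding u_def using x i by (intro eq_vecI) auto
  ultimately have energy: "?e \<bullet> (Q *\<^sub>v ?e) = x \<bullet> (Q *\<^sub>v x) + u \<bullet> (Q *\<^sub>v u)"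
    using quadratic_form_diff[OF Qb(1,2) x(1) u, of 1] by simp
  have rho: "0 \<le> 1 - lo / hi" using Qb(3-5) by simp
  from G show thesis
  proof
    assume G: "G = supp_graph Q"
    \<comment> \<open>On \<open>P\<close> this reads \<open>Q u = -\<close> column \<open>i\<close>
      of \<open>Q\<close>. These are the normal equations, and their right-hand side is supported on
      neighbours of \<open>i\<close>.\<close>
    have Qu: "(Q *\<^sub>v u) $ a = (Q *\<^sub>v x) $ a - Q $$ (a, i)" if "a < n" for a
      unfolding u_def using Qb(1) x i that
      by (simp add: mult_minus_distrib_mat_vec[of Q n n])
    have "graph_dist (supp_graph Q) i a \<le> enat 1"
      if a: "a < n" "a \<in> P" "(Q *\<^sub>v u) $ a \<noteq> 0" for a
    proof -
      have "Q $$ (i, a) = Q $$ (a, i)"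
        using Qb(1,2) a i by (metis carrier_matD(1) carrier_matD(2) index_transpose_mat(1))
      then have "(i, a) \<in> supp_graph Q"
        using Qu[OF a(1)] orth a i Qb(1) unfolding supp_graph_def by auto
      then show ?thesis using graph_dist_edge[OF graph_dist_self, of i a _ 0] by simp
    qed
    then obtain u' where u': "u' \<in> carrier_vec n"
      and u'_supp: "\<And>a. a < n \<Longrightarrow> u' $ a \<noteq> 0 \<Longrightarrow> a \<in> P \<and> graph_dist G i a \<le> enat t"
      and err: "(u - u') \<bullet> (u - u') \<le> (1 - lo / hi) ^ t * (u \<bullet> u)"
      using richardson_approximation[OF Q u u_supp, of P i t] unfolding G by blast
    show thesis
    proof (rule that)
      show "?e + u' \<in> carrier_vec n" using u' by auto
      show "(?e + u') $ i = 1" using u' u'_supp[of i] i by auto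
      show "a = i \<or> a \<in> P \<and> graph_dist G i a \<le> enat (Suc t)" if "a < n" "(?e + u') $ a \<noteq> 0" for a
        using that u' u'_supp[OF that(1)] i graph_dist_mono[of G i a t "Suc t"] by (cases "a = i") auto
      have eq: "x - (?e + u') = u - u'"
        unfolding u_def using x u' by (intro eq_vecI) auto
      have "u \<bullet> u \<le> hi / lo"
        using Qb(6)[OF u] energy e_bound Qb(8)[OF x(1)] Qb(3) by (simp add: field_simps)
      have "(u - u') \<bullet> (Q *\<^sub>v (u - u')) \<le> hi * ((u - u') \<bullet> (u - u'))"
        using u u' by (intro Qb(7)) auto
      also have "\<dots> \<le> hi * ((1 - lo / hi) ^ t * (hi / lo))"
        using err \<open>u \<bullet> u \<le> hi / lo\<close> rho Qb(4)
        by (intro mult_left_mono order_trans[OF err]) auto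
      also have "\<dots> = hi\<^sup>2 / lo * 1 * (1 - lo / hi) ^ t" by (simp add: power2_eq_square)
      \<comment> \<open>The spare factor \<open>hi / lo \<ge> 1\<close> is inserted to reach the
        constant that the case of a sparse inverse produces.\<close>
      also have "\<dots> \<le> hi\<^sup>2 / lo * (hi / lo) * (1 - lo / hi) ^ t"
        using rho Qb(3-5) by (intro mult_left_mono mult_right_mono) auto
      also have "\<dots> = hi ^ 3 / lo\<^sup>2 * (1 - lo / hi) ^ t"
        by (simp add: power2_eq_square power3_eq_cube)
      finally show "(x - (?e + u')) \<bullet> (Q *\<^sub>v (x - (?e + u'))) \<le> hi ^ 3 / lo\<^sup>2 * (1 - lo / hi) ^ t"
        unfolding eq .
    qed
  next
    assume G: "G = supp_graph R"
    note Rf = form_bounds_inverse[OF Q R]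
    note Rb = form_boundsD[OF Rf]
    define w where "w = Q *\<^sub>v x"
    have w: "w \<in> carrier_vec n" unfolding w_def by (rule Qx)
    have Rw: "R *\<^sub>v w = x"
      unfolding w_def using Qb(1) R x by (metis assoc_mult_mat_vec one_mult_mat_vec)
    \<comment> \<open>Inversion preserves the ratio of the bounds, hence the contraction
      factor.\<close>
    have ratio: "1 / hi / (1 / lo) = lo / hi" using Qb(3,4) by simp
    obtain w' where w': "w' \<in> carrier_vec n"
      and w'_supp: "\<And>a. a < n \<Longrightarrow> w' $ a \<noteq> 0 \<Longrightarrow> graph_dist G i a \<le> enat t"
      and err: "(w - w') \<bullet> (w - w') \<le> (1 - lo / hi) ^ t * (w \<bullet> w)"
    proof -
      have "\<And>a. a < n \<Longrightarrow> a \<notin> - P \<Longrightarrow> w $ a = 0" using orth unfolding w_def by auto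
      moreover have "graph_dist (supp_graph R) i a \<le> enat 1"
        if "a < n" "a \<in> - P" "(R *\<^sub>v w) $ a \<noteq> 0" for a
        using that x_supp graph_dist_self unfolding Rw by blast
      ultimately show thesis
        using that richardson_approximation[OF Rf w, of "- P" i t] unfolding G ratio by blast
    qed
    have Rw': "R *\<^sub>v w' \<in> carrier_vec n" using R w' by auto
    \<comment> \<open>Going back from \<open>w'\<close> to coefficients multiplies by
      \<open>R\<close> and costs one more neighbourhood, which accounts for \<open>Suc t\<close>.
      Restricting to \<open>P\<close> and adding the unit vector restores the required support and
      the entry 1 at \<open>i\<close>.\<close>
    define y where "y = restrict_vec P (R *\<^sub>v w')"
    have y: "y \<in> carrier_vec n" unfolding y_def using Rw' by simp
    have y_index: "y $ a = (if a \<in> P then (R *\<^sub>v w') $ a else 0)" if "a < n" for a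
      unfolding y_def by (rule restrict_vec_index[OF Rw' that])
    show thesis
    proof (rule that)
      show "?e + y \<in> carrier_vec n" using y by auto
      show "(?e + y) $ i = 1" using y y_index[of i] i by auto
      show "a = i \<or> a \<in> P \<and> graph_dist G i a \<le> enat (Suc t)" if a: "a < n" "(?e + y) $ a \<noteq> 0" for a
      proof (cases "a = i")
        case False
        then have "a \<in> P" "(R *\<^sub>v w') $ a \<noteq> 0"
          using a y y_index[OF a(1)] i by (auto split: if_splits)
        then show ?thesis
          using mult_mat_vec_support[OF Rb(1,2) w' _ a(1), of i t] w'_supp unfolding G by auto
      qed simp
      have d: "w - w' \<in> carrier_vec n" using w w' by auto
      have Rd: "(R *\<^sub>v (w - w')) $ a = x $ a - (R *\<^sub>v w') $ a" if "a < n" for a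
        using R w w' that Rw by (simp add: mult_minus_distrib_mat_vec[of R n n] del: index_mult_mat_vec)
      have eq: "x - (?e + y) = restrict_vec P (R *\<^sub>v (w - w'))"
      proof (rule eq_vecI)
        fix a assume "a < dim_vec (restrict_vec P (R *\<^sub>v (w - w')))"
        then have a: "a < n" using R by (simp add: restrict_vec_def)
        have "R *\<^sub>v (w - w') \<in> carrier_vec n" using R d by auto
        then show "(x - (?e + y)) $ a = restrict_vec P (R *\<^sub>v (w - w')) $ a"
          using a x x_supp[OF a] y i y_index[OF a] Rd[OF a]
          by (cases "a = i") auto
      qed (use R y in \<open>auto simp: restrict_vec_def\<close>)
      have xv: "x - (?e + y) \<in> carrier_vec n" using x y by auto
      have ww: "w \<bullet> w \<le> hi\<^sup>2"
      proof -
        have "w \<bullet> w \<le> hi * (x \<bullet> (Q *\<^sub>v x))" unfolding w_def by (rule Qb(9)[OF x(1)])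
        also have "\<dots> \<le> hi * hi"
          using energy e_bound Qb(8)[OF u] Qb(4) by (intro mult_left_mono) auto
        finally show ?thesis by (simp add: power2_eq_square)
      qed
      have "(x - (?e + y)) \<bullet> (Q *\<^sub>v (x - (?e + y))) \<le> hi * ((x - (?e + y)) \<bullet> (x - (?e + y)))"
        by (rule Qb(7)[OF xv])
      also have "\<dots> \<le> hi * ((R *\<^sub>v (w - w')) \<bullet> (R *\<^sub>v (w - w')))"
        unfolding eq using Qb(4) by (intro mult_left_mono scalar_prod_restrict_vec_le) auto
      \<comment> \<open>The squared norm of \<open>R d\<close> costs two factors
        \<open>1 / lo\<close>: one from \<open>R^2 \<le> R / lo\<close>, one from
        \<open>R \<le> I / lo\<close>.\<close>
      also have "\<dots> \<le> hi * (1 / lo * (1 / lo * ((w - w') \<bullet> (w - w'))))"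
        using Qb(3,4) Rb(7)[OF d]
        by (intro mult_left_mono order_trans[OF Rb(9)[OF d]]) auto
      also have "\<dots> \<le> hi * (1 / lo * (1 / lo * ((1 - lo / hi) ^ t * hi\<^sup>2)))"
        using Qb(3,4) rho ww by (intro mult_left_mono order_trans[OF err]) auto
      also have "\<dots> = hi ^ 3 / lo\<^sup>2 * (1 - lo / hi) ^ t"
        by (simp add: power2_eq_square power3_eq_cube)
      finally show "(x - (?e + y)) \<bullet> (Q *\<^sub>v (x - (?e + y))) \<le> hi ^ 3 / lo\<^sup>2 * (1 - lo / hi) ^ t" .
    qed
  qed
qed

subsection \<open>Stored matrices\<close>

text \<open>Row \<open>a\<close> is the residual of row \<open>k + a\<close> of \<open>F\<close>
  after orthogonal projection onto the rows in \<open>P\<close>. The two last conditions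
  characterise it: it differs from that row by a combination of rows in \<open>P\<close> and is
  orthogonal to them. The coefficients \<open>x\<close> are recorded because the decay argument
  concerns them.\<close>

definition residual_matrix :: "real mat \<Rightarrow> nat \<Rightarrow> nat set \<Rightarrow> real mat \<Rightarrow> bool" where
  "residual_matrix F k P H \<longleftrightarrow>
     H \<in> carrier_mat (dim_row F - k) (dim_col F) \<and> P \<subseteq> {..<k} \<and>
     (\<forall>a<dim_row F - k. \<exists>x\<in>carrier_vec (dim_row F).
        row H a = F\<^sup>T *\<^sub>v x \<and> x $ (k + a) = 1 \<and>
        (\<forall>b<dim_row F. x $ b \<noteq> 0 \<longrightarrow> b = k + a \<or> b \<in> P) \<and>
        (\<forall>b<dim_row F. b \<in> P \<longrightarrow> (F *\<^sub>v row H a) $ b = 0))"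

lemma residual_matrix_initial: "residual_matrix F 0 {} F"
proof -
  have "row F a = F\<^sup>T *\<^sub>v unit_vec (dim_row F) a" if "a < dim_row F" for a
    using that by (intro eq_vecI) auto
  then show ?thesis
    unfolding residual_matrix_def
    by (auto intro!: bexI[of _ "unit_vec (dim_row F) _"] split: if_splits)
qed

lemma row_mult_project:
  fixes D :: "real mat"
  assumes "D \<in> carrier_mat r m" "w \<in> carrier_vec m" "a < r"
  shows "row (D * (1\<^sub>m m - outer w)) a = row D a - (row D a \<bullet> w) \<cdot>\<^sub>v w"
proof (rule eq_vecI)
  fix j assume "j < dim_vec (row D a - (row D a \<bullet> w) \<cdot>\<^sub>v w)"
  then have j: "j < m" using assms by simp
  have col: "col (1\<^sub>m m - outer w) j = unit_vec m j - w $ j \<cdot>\<^sub>v w"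
    using assms j by (intro eq_vecI) (auto simp: outer_def unit_vec_def)
  have carr: "row D a \<in> carrier_vec m" using assms by auto
  have "row (D * (1\<^sub>m m - outer w)) a $ j = row D a \<bullet> col (1\<^sub>m m - outer w) j"
    using assms j by (simp add: outer_def)
  also have "\<dots> = row D a $ j - w $ j * (row D a \<bullet> w)"
    unfolding col using assms carr j
    by (simp add: scalar_prod_minus_distrib[of _ m])
  finally show "row (D * (1\<^sub>m m - outer w)) a $ j = (row D a - (row D a \<bullet> w) \<cdot>\<^sub>v w) $ j"
    using assms j by simp
qed (use assms in \<open>simp add: outer_def\<close>)

lemma row_drop_first_row:
  assumes "Suc a < dim_row H"
  shows "row (drop_first_row H) a = row H (Suc a)"
  using assms by (intro eq_vecI) (auto simp: drop_first_row_def)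

text \<open>The transition is one Gram-Schmidt step; the normalisation of the transition vector
  cancels, leaving the quotient \<open>(h \<bullet> u) / (u \<bullet> u)\<close>.\<close>

lemma row_child_mat:
  assumes H: "H \<in> carrier_mat r m" and a: "Suc a < r" and proj: "projecting \<epsilon> b H" and eps: "\<epsilon> > 0"
  shows "row (child_mat \<epsilon> b H) a =
    row H (Suc a) - ((row H (Suc a) \<bullet> row H 0) / (row H 0 \<bullet> row H 0)) \<cdot>\<^sub>v row H 0"
proof -
  let ?u = "row H 0" and ?h = "row H (Suc a)"
  define w where "w = (1 / vnorm ?u) \<cdot>\<^sub>v ?u"
  have u: "?u \<in> carrier_vec m" and h: "?h \<in> carrier_vec m" using H by auto
  have w: "w \<in> carrier_vec m" unfolding w_def using u by auto
  have sq: "vnorm ?u * vnorm ?u = ?u \<bullet> ?u"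
    unfolding vnorm_def by (simp add: scalar_prod_self_nonneg)
  have drop: "drop_first_row H \<in> carrier_mat (r - 1) m"
    using H by (auto simp: drop_first_row_def)
  have "row (child_mat \<epsilon> b H) a = row (drop_first_row H) a - (row (drop_first_row H) a \<bullet> w) \<cdot>\<^sub>v w"
    using H proj row_mult_project[OF drop w, of a] a
    by (simp add: child_mat_def transition_vec_def w_def)
  also have "row (drop_first_row H) a = ?h"
    using row_drop_first_row[of a H] a H by auto
  also have "(?h \<bullet> w) \<cdot>\<^sub>v w = ((?h \<bullet> ?u) / (?u \<bullet> ?u)) \<cdot>\<^sub>v ?u"
    unfolding w_def using u h sq by (simp add: smult_smult_assoc field_simps)
  finally show ?thesis .
qed

text \<open>A projecting arc adds \<open>k\<close> to \<open>P\<close>, any other arc leaves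
  \<open>P\<close> unchanged. In particular, skipping a short row only changes which set
  \<open>P\<close> is reached and introduces no error into the invariant.\<close>

lemma residual_matrix_child:
  assumes H: "residual_matrix F k P H" and k: "k < dim_row F" and eps: "\<epsilon> > 0"
  shows "\<exists>P'. residual_matrix F (Suc k) P' (child_mat \<epsilon> b H)"
proof -
  define n where "n = dim_row F"
  define m where "m = dim_col F"
  have F: "F \<in> carrier_mat n m" unfolding n_def m_def by auto
  have kn: "k < n" using k unfolding n_def .
  note defs = H[unfolded residual_matrix_def, folded n_def m_def]
  have Hc: "H \<in> carrier_mat (n - k) m" and P: "P \<subseteq> {..<k}" using defs by auto
  have child_c: "child_mat \<epsilon> b H \<in> carrier_mat (n - Suc k) m"
    using Hc by (auto simp: child_mat_def drop_first_row_def transition_vec_def outer_def)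
  have rows: "\<exists>x\<in>carrier_vec n. row H a = F\<^sup>T *\<^sub>v x \<and> x $ (k + a) = 1 \<and>
        (\<forall>b<n. x $ b \<noteq> 0 \<longrightarrow> b = k + a \<or> b \<in> P) \<and>
        (\<forall>b<n. b \<in> P \<longrightarrow> (F *\<^sub>v row H a) $ b = 0)" if "a < n - k" for a
    using defs that by blast
  show ?thesis
  proof (cases "projecting \<epsilon> b H")
    case False
    have "\<exists>x\<in>carrier_vec n. row (child_mat \<epsilon> b H) a = F\<^sup>T *\<^sub>v x \<and> x $ (Suc k + a) = 1 \<and>
        (\<forall>b<n. x $ b \<noteq> 0 \<longrightarrow> b = Suc k + a \<or> b \<in> P) \<and>
        (\<forall>b'<n. b' \<in> P \<longrightarrow> (F *\<^sub>v row (child_mat \<epsilon> b H) a) $ b' = 0)" if a: "a < n - Suc k" for a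
    proof -
      have "row (child_mat \<epsilon> b H) a = row H (Suc a)"
        using False row_drop_first_row[of a H] Hc a by (auto simp: child_mat_def)
      then show ?thesis using rows[of "Suc a"] a by simp
    qed
    then have "residual_matrix F (Suc k) P (child_mat \<epsilon> b H)"
      unfolding residual_matrix_def n_def[symmetric] m_def[symmetric]
      using child_c P by auto
    then show ?thesis by blast
  next
    case True
    define u where "u = row H 0"
    have u: "u \<in> carrier_vec m" unfolding u_def using Hc by auto
    have "0 < vnorm u" using True eps unfolding projecting_def u_def by linarith
    then have uu: "u \<bullet> u > 0" unfolding vnorm_def by simp
    obtain y where y: "y \<in> carrier_vec n" "u = F\<^sup>T *\<^sub>v y" "y $ k = 1"
      and y_supp: "\<And>b. b < n \<Longrightarrow> y $ b \<noteq> 0 \<Longrightarrow> b = k \<or> b \<in> P"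
      and y_orth: "\<And>b. b < n \<Longrightarrow> b \<in> P \<Longrightarrow> (F *\<^sub>v u) $ b = 0"
      using rows[of 0] kn unfolding u_def by auto
    have "\<exists>z\<in>carrier_vec n. row (child_mat \<epsilon> b H) a = F\<^sup>T *\<^sub>v z \<and> z $ (Suc k + a) = 1 \<and>
        (\<forall>b<n. z $ b \<noteq> 0 \<longrightarrow> b = Suc k + a \<or> b \<in> insert k P) \<and>
        (\<forall>j<n. j \<in> insert k P \<longrightarrow> (F *\<^sub>v row (child_mat \<epsilon> b H) a) $ j = 0)"
      if a: "a < n - Suc k" for a
    proof -
      define h where "h = row H (Suc a)"
      have h: "h \<in> carrier_vec m" unfolding h_def using Hc by auto
      obtain x where x: "x \<in> carrier_vec n" "h = F\<^sup>T *\<^sub>v x" "x $ (Suc k + a) = 1"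
        and x_supp: "\<And>b. b < n \<Longrightarrow> x $ b \<noteq> 0 \<Longrightarrow> b = Suc k + a \<or> b \<in> P"
        and x_orth: "\<And>b. b < n \<Longrightarrow> b \<in> P \<Longrightarrow> (F *\<^sub>v h) $ b = 0"
      proof -
        have "Suc a < n - k" using a by linarith
        then show thesis using rows[of "Suc a"] that unfolding h_def add_Suc_shift by blast
      qed
      define c where "c = (h \<bullet> u) / (u \<bullet> u)"
      define g where "g = h - c \<cdot>\<^sub>v u"
      have g: "g \<in> carrier_vec m" unfolding g_def using h u by auto
      have row_g: "row (child_mat \<epsilon> b H) a = g"
        unfolding g_def c_def h_def u_def using row_child_mat[OF Hc _ True eps] a by auto
      \<comment> \<open>Gram-Schmidt acts on the coefficients in the same way as on the
        rows.\<close>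
      define z where "z = x - c \<cdot>\<^sub>v y"
      have z: "z \<in> carrier_vec n" unfolding z_def using x y by auto
      have "g = F\<^sup>T *\<^sub>v z"
        unfolding g_def z_def x(2) y(2) using F x(1) y(1)
        by (simp add: mult_minus_distrib_mat_vec[of _ m n] mult_mat_vec[of _ m n])
      moreover have "z $ (Suc k + a) = 1"
      proof -
        \<comment> \<open>The support of \<open>y\<close> lies in \<open>P\<close> and
          \<open>k\<close>, hence below \<open>Suc k\<close>, so the leading coefficient 1 of
          \<open>x\<close> survives.\<close>
        have "y $ (Suc k + a) = 0" using y_supp[of "Suc k + a"] P a by (force simp: subset_iff)
        then show ?thesis unfolding z_def using x y a by auto
      qed
      moreover have "b = Suc k + a \<or> b \<in> insert k P" if "b < n" "z $ b \<noteq> 0" for b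
        using that x_supp[of b] y_supp[of b] x(1) y(1) unfolding z_def by force
      moreover have "(F *\<^sub>v g) $ b = 0" if b: "b < n" "b \<in> insert k P" for b
      proof -
        have Pcase: "(F *\<^sub>v g) $ b = 0" if "b < n" "b \<in> P" for b
          using x_orth[OF that] y_orth[OF that] F h u that unfolding g_def
          by (simp add: scalar_prod_minus_distrib[of _ m])
        have "(F *\<^sub>v g) $ k = 0"
        proof -
          have Fg: "F *\<^sub>v g \<in> carrier_vec n" using F g by auto
          \<comment> \<open>\<open>y\<close> differs from the \<open>k\<close>-th unit vector only
            on \<open>P\<close>, where \<open>F g\<close> vanishes. The entry at \<open>k\<close> is
            therefore \<open>u \<bullet> g\<close>, which is zero by the choice of
            \<open>c\<close>.\<close>
          have "(y - unit_vec n k) \<bullet> (F *\<^sub>v g) = 0"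
          proof (rule scalar_prod_disjoint_support[OF Fg])
            fix b assume "b < n"
            then show "(y - unit_vec n k) $ b = 0 \<or> (F *\<^sub>v g) $ b = 0"
              using y y_supp[of b] Pcase[of b] kn by (cases "b = k") auto
          qed
          then have "(F *\<^sub>v g) $ k = y \<bullet> (F *\<^sub>v g)"
            using y Fg kn by (simp add: minus_scalar_prod_distrib[of _ n] del: index_mult_mat_vec)
          also have "\<dots> = u \<bullet> g"
            unfolding y(2) using transpose_vec_mult_scalar[OF F g y(1)] by simp
          also have "\<dots> = u \<bullet> h - c * (u \<bullet> u)"
            unfolding g_def using u h by (simp add: scalar_prod_minus_distrib[of _ m])
          also have "\<dots> = 0"
            unfolding c_def using uu comm_scalar_prod[OF u h] by simp
          finally show ?thesis .
        qed
        with Pcase b show ?thesis by auto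
      qed
      ultimately show ?thesis using z unfolding row_g by blast
    qed
    then have "residual_matrix F (Suc k) (insert k P) (child_mat \<epsilon> b H)"
      unfolding residual_matrix_def n_def[symmetric] m_def[symmetric]
      using child_c P by auto
    then show ?thesis by blast
  qed
qed

lemma norm_2_inf_le:
  assumes "0 \<le> c" "\<And>a. a < dim_row H \<Longrightarrow> row H a \<bullet> row H a \<le> c\<^sup>2"
  shows "norm_2_inf H \<le> c"
  unfolding norm_2_inf_def vnorm_def using assms by (auto intro!: real_le_lsqrt)

text \<open>Two corresponding rows have local approximations whose coefficients are 1 at
  \<open>i\<close> and otherwise supported on the common part of \<open>P\<close> and
  \<open>P'\<close>. The difference \<open>d\<close> of the rows is orthogonal to that common part,
  so it is controlled by the two approximation errors alone.\<close>

lemma residual_matrix_close: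
  assumes Q: "form_bounds (dim_row F) (F * F\<^sup>T) lo hi"
    and R: "R \<in> carrier_mat (dim_row F) (dim_row F)"
      "(F * F\<^sup>T) * R = 1\<^sub>m (dim_row F)" "R * (F * F\<^sup>T) = 1\<^sub>m (dim_row F)"
    and G: "G = supp_graph (F * F\<^sup>T) \<or> G = supp_graph R"
    and H: "residual_matrix F k P H" and H': "residual_matrix F k P' H'"
    and agree: "P \<inter> boundary (dim_row F) G (Suc t) k = P' \<inter> boundary (dim_row F) G (Suc t) k"
    and small: "4 * (hi ^ 3 / lo\<^sup>2 * (1 - lo / hi) ^ t) \<le> \<epsilon>\<^sup>2" and eps: "\<epsilon> \<ge> 0"
  shows "norm_2_inf (H - H') \<le> \<epsilon>"
proof (rule norm_2_inf_le[OF eps])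
  fix a assume a: "a < dim_row (H - H')"
  define n where "n = dim_row F"
  define m where "m = dim_col F"
  have F: "F \<in> carrier_mat n m" unfolding n_def m_def by auto
  have FT: "F\<^sup>T \<in> carrier_mat m n" using F by auto
  note defs = H[unfolded residual_matrix_def, folded n_def m_def]
    H'[unfolded residual_matrix_def, folded n_def m_def]
  define \<Lambda> where "\<Lambda> = boundary n G (Suc t) k"
  define C where "C = hi ^ 3 / lo\<^sup>2 * (1 - lo / hi) ^ t"
  have a: "a < n - k" using a defs by auto
  define i where "i = k + a"
  have i: "i < n" "k \<le> i" unfolding i_def using a by auto
  have approx: "\<exists>v\<in>carrier_vec n. v $ i = 1 \<and> (\<forall>b<n. v $ b \<noteq> 0 \<longrightarrow> b = i \<or> b \<in> P1 \<inter> \<Lambda>) \<and>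
      (row H1 a - F\<^sup>T *\<^sub>v v) \<bullet> (row H1 a - F\<^sup>T *\<^sub>v v) \<le> C \<and>
      (\<forall>b<n. b \<in> P1 \<longrightarrow> (F *\<^sub>v row H1 a) $ b = 0) \<and> row H1 a \<in> carrier_vec m"
    if res: "residual_matrix F k P1 H1" for P1 H1
  proof -
    note defs1 = res[unfolded residual_matrix_def, folded n_def m_def]
    obtain x where x: "x \<in> carrier_vec n" "row H1 a = F\<^sup>T *\<^sub>v x" "x $ i = 1"
      and x_supp: "\<And>b. b < n \<Longrightarrow> x $ b \<noteq> 0 \<Longrightarrow> b = i \<or> b \<in> P1"
      and x_orth: "\<forall>b<n. b \<in> P1 \<longrightarrow> (F *\<^sub>v row H1 a) $ b = 0"
      using defs1 a unfolding i_def by blast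
    have P1: "P1 \<subseteq> {..<k}" using defs1 by auto
    have orth: "((F * F\<^sup>T) *\<^sub>v x) $ b = 0" if "b < n" "b \<in> P1" for b
      using x_orth that x assoc_mult_mat_vec[OF F FT x(1)] by auto
    have "i \<notin> P1" using P1 i by auto
    obtain v where v: "v \<in> carrier_vec n" "v $ i = 1"
      and v_supp: "\<And>b. b < n \<Longrightarrow> v $ b \<noteq> 0 \<Longrightarrow> b = i \<or> b \<in> P1 \<and> graph_dist G i b \<le> enat (Suc t)"
      and v_err: "(x - v) \<bullet> ((F * F\<^sup>T) *\<^sub>v (x - v)) \<le> C"
      unfolding C_def
      using residual_local_approximation[OF Q[folded n_def] R[folded n_def] G i(1) \<open>i \<notin> P1\<close> x(1,3) x_supp orth, of t]
      by blast
    \<comment> \<open>Since \<open>b < k \<le> i\<close>, closeness of \<open>b\<close> to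
      \<open>i\<close> puts \<open>b\<close> into the boundary.\<close>
    have "b = i \<or> b \<in> P1 \<inter> \<Lambda>" if "b < n" "v $ b \<noteq> 0" for b
      using v_supp[OF that] P1 i unfolding \<Lambda>_def boundary_def by auto
    moreover have "(row H1 a - F\<^sup>T *\<^sub>v v) \<bullet> (row H1 a - F\<^sup>T *\<^sub>v v) \<le> C"
    proof -
      have xv: "x - v \<in> carrier_vec n" using x v by auto
      have FTxv: "F\<^sup>T *\<^sub>v (x - v) \<in> carrier_vec m" using FT xv by auto
      have "row H1 a - F\<^sup>T *\<^sub>v v = F\<^sup>T *\<^sub>v (x - v)"
        unfolding x(2) using mult_minus_distrib_mat_vec[OF FT x(1) v(1)] by simp
      moreover have "(F\<^sup>T *\<^sub>v (x - v)) \<bullet> (F\<^sup>T *\<^sub>v (x - v)) = (x - v) \<bullet> (F *\<^sub>v (F\<^sup>T *\<^sub>v (x - v)))"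
        by (rule transpose_vec_mult_scalar[OF F FTxv xv])
      ultimately show ?thesis using v_err assoc_mult_mat_vec[OF F FT xv] by simp
    qed
    moreover have "row H1 a \<in> carrier_vec m" using defs1 by auto
    ultimately show ?thesis using v x_orth by blast
  qed
  define h where "h = row H a"
  define h' where "h' = row H' a"
  obtain v where v: "v \<in> carrier_vec n" "v $ i = 1"
    and v_supp: "\<And>b. b < n \<Longrightarrow> v $ b \<noteq> 0 \<Longrightarrow> b = i \<or> b \<in> P \<inter> \<Lambda>"
    and v_err: "(h - F\<^sup>T *\<^sub>v v) \<bullet> (h - F\<^sup>T *\<^sub>v v) \<le> C"
    and h: "\<And>b. b < n \<Longrightarrow> b \<in> P \<Longrightarrow> (F *\<^sub>v h) $ b = 0" "h \<in> carrier_vec m"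
    using approx[OF H] unfolding h_def by blast
  obtain v' where v': "v' \<in> carrier_vec n" "v' $ i = 1"
    and v'_supp: "\<And>b. b < n \<Longrightarrow> v' $ b \<noteq> 0 \<Longrightarrow> b = i \<or> b \<in> P' \<inter> \<Lambda>"
    and v'_err: "(h' - F\<^sup>T *\<^sub>v v') \<bullet> (h' - F\<^sup>T *\<^sub>v v') \<le> C"
    and h': "\<And>b. b < n \<Longrightarrow> b \<in> P' \<Longrightarrow> (F *\<^sub>v h') $ b = 0" "h' \<in> carrier_vec m"
    using approx[OF H'] unfolding h'_def by blast
  define s where "s = h - F\<^sup>T *\<^sub>v v"
  define s' where "s' = h' - F\<^sup>T *\<^sub>v v'"
  define d where "d = h - h'"
  have carr: "F\<^sup>T *\<^sub>v v \<in> carrier_vec m" "F\<^sup>T *\<^sub>v v' \<in> carrier_vec m" using FT v v' by auto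
  have s: "s \<in> carrier_vec m" "s' \<in> carrier_vec m" "d \<in> carrier_vec m"
    unfolding s_def s'_def d_def using h h' carr by auto
  have vv: "v - v' \<in> carrier_vec n" using v v' by auto
  \<comment> \<open>The entries of \<open>v\<close> and \<open>v'\<close> at \<open>i\<close>
    cancel, and elsewhere \<open>v - v'\<close> is supported on rows to which both residuals are
    orthogonal.\<close>
  have "d \<bullet> (F\<^sup>T *\<^sub>v (v - v')) = (v - v') \<bullet> (F *\<^sub>v d)"
    using transpose_vec_mult_scalar[OF F s(3) vv] FT vv s(3)
    by (metis comm_scalar_prod mult_mat_vec_carrier)
  also have "\<dots> = 0"
  proof (rule scalar_prod_disjoint_support)
    show "F *\<^sub>v d \<in> carrier_vec n" using F s by auto
    fix b assume b: "b < n"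
    have common: "b \<in> P \<and> b \<in> P'" if "b \<noteq> i" "(v - v') $ b \<noteq> 0"
    proof -
      have "v $ b \<noteq> 0 \<or> v' $ b \<noteq> 0" using that b v v' by auto
      then show ?thesis
        using v_supp[OF b] v'_supp[OF b] that agree[folded n_def, folded \<Lambda>_def] by auto
    qed
    have "(F *\<^sub>v d) $ b = 0" if "b \<in> P" "b \<in> P'"
      using that h h' b F unfolding d_def by (simp add: scalar_prod_minus_distrib[of _ m])
    then show "(v - v') $ b = 0 \<or> (F *\<^sub>v d) $ b = 0"
      using common b v v' by (cases "b = i") auto
  qed
  also have "F\<^sup>T *\<^sub>v (v - v') = d - (s - s')"
    unfolding mult_minus_distrib_mat_vec[OF FT v(1) v'(1)] d_def s_def s'_def
    using h h' carr F by (intro eq_vecI) auto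
  finally have dd: "d \<bullet> d = d \<bullet> (s - s')"
    using s by (simp add: scalar_prod_minus_distrib[of _ m])
  \<comment> \<open>The mean inequality turns \<open>d \<bullet> d = d \<bullet> (s - s')\<close>
    into a bound by the squared norm of \<open>s - s'\<close>.\<close>
  have "2 * (d \<bullet> (s - s')) \<le> (s - s') \<bullet> (s - s') + d \<bullet> d"
    using s by (intro scalar_prod_le_mean[of _ m]) auto
  then have "d \<bullet> d \<le> (s - s') \<bullet> (s - s')" using dd by linarith
  also have "\<dots> = s \<bullet> s - 2 * (s' \<bullet> s) + s' \<bullet> s'"
    using scalar_prod_self_diff[OF s(1,2), of 1] by simp
  also have "\<dots> \<le> 2 * (s \<bullet> s) + 2 * (s' \<bullet> s')"
  proof -
    have "2 * (s' \<bullet> (- s)) \<le> (- s) \<bullet> (- s) + s' \<bullet> s'"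
      using s by (intro scalar_prod_le_mean[of _ m]) auto
    then show ?thesis using s by simp
  qed
  also have "\<dots> \<le> 4 * C" using v_err v'_err unfolding s_def s'_def by linarith
  also have "\<dots> \<le> \<epsilon>\<^sup>2" using small unfolding C_def .
  also have "d = row (H - H') a"
    unfolding d_def h_def h'_def using defs a by (intro eq_vecI) auto
  finally show "row (H - H') a \<bullet> row (H - H') a \<le> \<epsilon>\<^sup>2" .
qed

subsection \<open>Merging\<close>

text \<open>While two nodes share a class they may be merged, and the survivor still represents that
  class. Merging never changes a stored matrix, so the closeness assumption persists and no chain of
  approximations arises.\<close>

lemma merge_by_class:
  assumes "finite V"
    and "\<And>v w. v \<in> V \<Longrightarrow> w \<in> V \<Longrightarrow> c v = c w \<Longrightarrow> norm_2_inf (stored v - stored w) \<le> \<epsilon>"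
  shows "\<exists>V' A'. (merge \<epsilon>)\<^sup>*\<^sup>* (V, A) (V', A') \<and> V' \<subseteq> V \<and> c ` V' = c ` V \<and> inj_on c V'"
  using assms
proof (induction "card V" arbitrary: V A rule: less_induct)
  case less
  show ?case
  proof (cases "inj_on c V")
    case True
    then show ?thesis by blast
  next
    case False
    then obtain v w where vw: "v \<in> V" "w \<in> V" "v \<noteq> w" "c v = c w"
      unfolding inj_on_def by blast
    have step: "merge \<epsilon> (V, A) (V - {w}, redirect w v ` A)"
      using vw less.prems(2) by (intro merge.intros) auto
    have "card (V - {w}) < card V"
      using vw less.prems(1) by (meson card_Diff1_less)
    then obtain V' A' where V': "(merge \<epsilon>)\<^sup>*\<^sup>* (V - {w}, redirect w v ` A) (V', A')"
      "V' \<subseteq> V - {w}" "c ` V' = c ` (V - {w})" "inj_on c V'"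
      using less.hyps[of "V - {w}" "redirect w v ` A"] less.prems by fastforce
    have "c ` (V - {w}) = c ` V"
      using vw by (auto simp: image_iff) (metis Diff_iff empty_iff insert_iff)
    moreover have "(merge \<epsilon>)\<^sup>*\<^sup>* (V, A) (V', A')"
      using step V'(1) by (rule converse_rtranclp_into_rtranclp[of "merge \<epsilon>"])
    ultimately show ?thesis using V'(2-4) by blast
  qed
qed

lemma finite_children: "finite V \<Longrightarrow> finite (children \<epsilon> V)"
proof -
  assume "finite V"
  moreover have "children \<epsilon> V = (\<lambda>(b, v). child \<epsilon> b v) ` (UNIV \<times> V)"
    unfolding children_def by auto
  ultimately show ?thesis by simp
qed

text \<open>In each layer the nodes are classified by the trace of their sets \<open>P\<close> on
  \<open>\<Lambda> k\<close>; one node per class leaves at most as many nodes as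
  \<open>\<Lambda> k\<close> has subsets.\<close>

lemma eps_exact_diagram_exists:
  assumes eps: "\<epsilon> > 0"
    and fin: "\<And>k. k \<le> dim_row F \<Longrightarrow> finite (\<Lambda> k)" and last: "\<Lambda> (dim_row F) = {}"
    and close: "\<And>k P P' H H'. k \<le> dim_row F \<Longrightarrow> residual_matrix F k P H \<Longrightarrow> residual_matrix F k P' H' \<Longrightarrow>
      P \<inter> \<Lambda> k = P' \<inter> \<Lambda> k \<Longrightarrow> norm_2_inf (H - H') \<le> \<epsilon>"
  shows "\<exists>D. eps_exact_diagram F \<epsilon> D \<and> num_nodes D \<le> (\<Sum>k\<le>dim_row F. 2 ^ card (\<Lambda> k))"
proof -
  let ?n = "dim_row F"
  \<comment> \<open>Dependent choice yields an infinite sequence of layers; beyond layer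
    \<open>?n\<close> the invariant holds vacuously.\<close>
  let ?inv = "\<lambda>k V. (k = 0 \<longrightarrow> V = {Node [] F}) \<and> (k \<le> ?n \<longrightarrow> finite V \<and> V \<noteq> {} \<and>
    (\<forall>v\<in>V. \<exists>P. residual_matrix F k P (stored v)) \<and> card V \<le> 2 ^ card (\<Lambda> k))"
  let ?step = "\<lambda>k V V'. k < ?n \<longrightarrow>
    (\<exists>A. (merge \<epsilon>)\<^sup>*\<^sup>* (children \<epsilon> V, out_arcs \<epsilon> V) (V', A))"
  have "\<exists>Vs. \<forall>k. ?inv k (Vs k) \<and> ?step k (Vs k) (Vs (Suc k))"
  proof (rule dependent_nat_choice)
    show "\<exists>V. ?inv 0 V"
      using residual_matrix_initial[of F] by (intro exI[of _ "{Node [] F}"]) auto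
  next
    fix V k assume inv: "?inv k V"
    show "\<exists>V'. ?inv (Suc k) V' \<and> ?step k V V'"
    proof (cases "k < ?n")
      case False
      then show ?thesis by (intro exI[of _ V]) simp
    next
      case True
      let ?C = "children \<epsilon> V"
      have "\<exists>P. residual_matrix F (Suc k) P (stored v)" if v: "v \<in> ?C" for v
      proof -
        obtain b u where u: "u \<in> V" "v = child \<epsilon> b u" using v unfolding children_def by blast
        then obtain P where "residual_matrix F k P (stored u)" using inv True by auto
        then show ?thesis using residual_matrix_child[OF _ True eps] unfolding u child_def by simp
      qed
      then obtain P where P: "\<And>v. v \<in> ?C \<Longrightarrow> residual_matrix F (Suc k) (P v) (stored v)"
        by metis
      define c where "c v = P v \<inter> \<Lambda> (Suc k)" for v
      have finC: "finite ?C" using inv True by (simp add: finite_children)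
      have closeC: "norm_2_inf (stored v - stored w) \<le> \<epsilon>" if "v \<in> ?C" "w \<in> ?C" "c v = c w" for v w
        using close[OF _ P[OF that(1)] P[OF that(2)]] that(3) True unfolding c_def by simp
      have "\<exists>V' A. (merge \<epsilon>)\<^sup>*\<^sup>* (?C, out_arcs \<epsilon> V) (V', A) \<and> V' \<subseteq> ?C \<and> c ` V' = c ` ?C \<and> inj_on c V'"
        by (rule merge_by_class[OF finC]) (rule closeC)
      then obtain V' A where V': "(merge \<epsilon>)\<^sup>*\<^sup>* (?C, out_arcs \<epsilon> V) (V', A)"
        "V' \<subseteq> ?C" "c ` V' = c ` ?C" "inj_on c V'"
        by (elim exE conjE)
      have "?C \<noteq> {}" using inv True unfolding children_def by auto
      then have "V' \<noteq> {}" using V'(3) by (metis image_is_empty)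
      moreover have "card V' \<le> 2 ^ card (\<Lambda> (Suc k))"
      proof -
        have "card V' = card (c ` V')" using V'(4) by (simp add: card_image)
        also have "\<dots> \<le> card (Pow (\<Lambda> (Suc k)))"
          using fin[of "Suc k"] True by (intro card_mono) (auto simp: c_def)
        also have "\<dots> = 2 ^ card (\<Lambda> (Suc k))" using fin[of "Suc k"] True by (simp add: card_Pow)
        finally show ?thesis .
      qed
      moreover have "finite V'" using V'(2) finC by (rule finite_subset)
      moreover have "\<forall>v\<in>V'. \<exists>P. residual_matrix F (Suc k) P (stored v)" using V'(2) P by blast
      ultimately have "?inv (Suc k) V'" by simp
      moreover have "?step k V V'" using V'(1) by (intro impI exI)
      ultimately have "?inv (Suc k) V' \<and> ?step k V V'" by (rule conjI)
      then show ?thesis by (rule exI)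
    qed
  qed
  then obtain Vs where all: "\<forall>k. ?inv k (Vs k) \<and> ?step k (Vs k) (Vs (Suc k))" ..
  have Vs: "?inv k (Vs k)" and step: "?step k (Vs k) (Vs (Suc k))" for k
    using all[THEN spec[of _ k]] by - (erule conjunct1, erule conjunct2)
  have "\<forall>k. \<exists>A. k < ?n \<longrightarrow> (merge \<epsilon>)\<^sup>*\<^sup>* (children \<epsilon> (Vs k), out_arcs \<epsilon> (Vs k)) (Vs (Suc k), A)"
  proof
    fix k show "\<exists>A. k < ?n \<longrightarrow> (merge \<epsilon>)\<^sup>*\<^sup>* (children \<epsilon> (Vs k), out_arcs \<epsilon> (Vs k)) (Vs (Suc k), A)"
      using step[of k] by (cases "k < ?n") auto
  qed
  then obtain As where As: "\<forall>k. k < ?n \<longrightarrow>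
      (merge \<epsilon>)\<^sup>*\<^sup>* (children \<epsilon> (Vs k), out_arcs \<epsilon> (Vs k)) (Vs (Suc k), As k)"
    by (rule choice[THEN exE])
  define D where "D = \<lparr>layers = map Vs [0..<Suc ?n], arcs = map As [0..<?n]\<rparr>"
  have layer: "layers D ! k = Vs k" if "k \<le> ?n" for k
    unfolding D_def using that by (simp del: upt_Suc)
  have "card (Vs ?n) = 1"
  proof -
    \<comment> \<open>The last boundary is empty, so there is a single class, and the layer is
      nonempty: this is the terminal node.\<close>
    have "card (Vs ?n) \<le> 1" "0 < card (Vs ?n)"
      using Vs[of ?n] last by (auto simp: card_gt_0_iff)
    then show ?thesis by linarith
  qed
  moreover have "layers D ! 0 = {Node [] F}"
    using layer[of 0] Vs[of 0] by simp
  moreover have "(merge \<epsilon>)\<^sup>*\<^sup>* (children \<epsilon> (layers D ! k), out_arcs \<epsilon> (layers D ! k))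
      (layers D ! Suc k, arcs D ! k)" if "k < ?n" for k
    using As[rule_format, OF that] layer[of k] layer[of "Suc k"] that by (simp add: D_def del: upt_Suc)
  ultimately have "eps_exact_diagram F \<epsilon> D"
    unfolding eps_exact_diagram_def using layer[of ?n] by (simp add: D_def del: upt_Suc)
  moreover have "num_nodes D \<le> (\<Sum>k\<le>?n. 2 ^ card (\<Lambda> k))"
  proof -
    have "num_nodes D = sum_list (map (\<lambda>k. card (Vs k)) [0..<Suc ?n])"
      unfolding num_nodes_def D_def by (simp add: comp_def del: upt_Suc)
    also have "\<dots> = (\<Sum>k\<le>?n. card (Vs k))"
      by (simp only: interv_sum_list_conv_sum_set_nat set_upt atLeast0LessThan lessThan_Suc_atMost)
    also have "\<dots> \<le> (\<Sum>k\<le>?n. 2 ^ card (\<Lambda> k))"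
    proof (rule sum_mono)
      fix k assume "k \<in> {..?n}"
      then show "card (Vs k) \<le> 2 ^ card (\<Lambda> k)" using Vs[of k] by simp
    qed
    finally show ?thesis .
  qed
  ultimately show ?thesis by blast
qed

section \<open>Spectral bounds of the Gram matrix and choice of the radius\<close>

lemma spectrum_positive:
  assumes Q: "Q \<in> carrier_mat n n" "positive_definite Q" and k: "k \<in> spectrum Q"
  shows "k > 0"
proof -
  obtain v where v: "v \<in> carrier_vec n" "v \<noteq> 0\<^sub>v n" "Q *\<^sub>v v = k \<cdot>\<^sub>v v"
    using Q(1) k unfolding spectrum_def eigenvalue_def eigenvector_def by auto
  then have "0 < v \<bullet> (k \<cdot>\<^sub>v v)"
    using Q unfolding positive_definite_def by (metis carrier_matD(1))
  then have "0 < k * (v \<bullet> v)" using v by simp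
  then show ?thesis
    using scalar_prod_self_pos[OF v(1,2)] by (simp add: zero_less_mult_iff)
qed

lemma positive_definite_form_bounds:
  assumes Q: "Q \<in> carrier_mat n n" "positive_definite Q" and n: "n \<ge> 1"
  shows "form_bounds n Q (Min (spectrum Q)) (Max (spectrum Q))"
proof -
  have sym: "Q\<^sup>T = Q" using Q unfolding positive_definite_def by simp
  note bounds = rayleigh_bounds[OF Q(1) sym n]
  have "Min (spectrum Q) \<in> spectrum Q" "Min (spectrum Q) \<le> Max (spectrum Q)"
    using bounds(3,4)[OF zero_carrier_vec] .
  then show ?thesis
    using Q sym bounds(1,2) spectrum_positive[OF Q] unfolding form_bounds_def by blast
qed

text \<open>Zero is not an eigenvalue, so the determinant is nonzero; this makes
  \<open>the (mat_inverse Q)\<close> the genuine inverse.\<close>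

lemma positive_definite_mat_inverse:
  assumes Q: "Q \<in> carrier_mat n n" "positive_definite Q"
  obtains R where "mat_inverse Q = Some R" "R \<in> carrier_mat n n" "Q * R = 1\<^sub>m n" "R * Q = 1\<^sub>m n"
proof -
  have "0 \<notin> spectrum Q" using spectrum_positive[OF Q] by blast
  moreover have "char_matrix Q 0 = Q"
    using Q(1) unfolding char_matrix_def by (intro eq_matI) auto
  ultimately have "det Q \<noteq> 0"
    using eigenvalue_det[OF Q(1), of 0] unfolding spectrum_def by simp
  from det_non_zero_imp_unit[OF Q(1) this, of "()"] have "mat_inverse Q \<noteq> None"
    using mat_inverse(1)[OF Q(1), where b = "()"] by blast
  then show thesis
    using that mat_inverse(2)[OF Q(1)] by blast
qed

text \<open>The number of iterations that brings the squared error bound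
  \<open>4 lmax^3 / lmin^2 (1 - lmin / lmax)^t\<close> down to \<open>\<epsilon>^2\<close>;
  \<open>nat\<close> gives 0 if the bound already holds at the start.\<close>

definition radius :: "real \<Rightarrow> real \<Rightarrow> real \<Rightarrow> nat" where
  "radius lmin lmax \<epsilon> = nat \<lceil>lmax / lmin * ln (4 * (lmax ^ 3 / lmin\<^sup>2) / \<epsilon>\<^sup>2)\<rceil>"

lemma radius_error:
  assumes l: "0 < lmin" "lmin \<le> lmax" and eps: "\<epsilon> > 0"
  shows "4 * (lmax ^ 3 / lmin\<^sup>2 * (1 - lmin / lmax) ^ radius lmin lmax \<epsilon>) \<le> \<epsilon>\<^sup>2"
proof -
  define X where "X = 4 * (lmax ^ 3 / lmin\<^sup>2) / \<epsilon>\<^sup>2"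
  define t where "t = radius lmin lmax \<epsilon>"
  have X: "X > 0" unfolding X_def using l eps by simp
  have "lmax / lmin * ln X \<le> real t"
    unfolding t_def radius_def X_def by linarith
  then have t: "ln X \<le> real t * (lmin / lmax)" using l by (simp add: field_simps)
  \<comment> \<open>The contraction factor is replaced by an exponential through
    \<open>1 - s \<le> exp (- s)\<close>.\<close>
  have "(1 - lmin / lmax) ^ t \<le> exp (- (lmin / lmax)) ^ t"
    using l exp_ge_add_one_self[of "- (lmin / lmax)"] by (intro power_mono) auto
  also have "\<dots> = exp (- (real t * (lmin / lmax)))"
    by (simp add: exp_of_nat_mult[symmetric])
  also have "\<dots> \<le> exp (- ln X)" using t by simp
  also have "\<dots> = 1 / X" using X by (simp add: exp_minus inverse_eq_divide)
  finally have "4 * (lmax ^ 3 / lmin\<^sup>2 * (1 - lmin / lmax) ^ t) \<le> 4 * (lmax ^ 3 / lmin\<^sup>2 * (1 / X))"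
    using l by (intro mult_left_mono) auto
  also have "\<dots> = \<epsilon>\<^sup>2" unfolding X_def using l eps by (simp add: field_simps)
  finally show ?thesis unfolding t_def .
qed

lemma radius_bigo:
  assumes l: "0 < lmin" "lmin \<le> lmax"
  shows "(\<lambda>\<epsilon>. real (Suc (radius lmin lmax \<epsilon>))) \<in> O[at_right 0](\<lambda>\<epsilon>. ln (1 / \<epsilon>))"
proof -
  define a where "a = lmax / lmin"
  define c where "c = 4 * (lmax ^ 3 / lmin\<^sup>2)"
  have pos: "a > 0" "c > 0" unfolding a_def c_def using l by auto
  \<comment> \<open>The summand 2 absorbs the rounding of the ceiling and the
    \<open>Suc\<close>.\<close>
  have "(\<lambda>\<epsilon>. real (Suc (radius lmin lmax \<epsilon>))) \<in> O[at_right 0](\<lambda>\<epsilon>. \<bar>a * ln (c / \<epsilon>\<^sup>2)\<bar> + 2)"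
    unfolding radius_def a_def[symmetric] c_def[symmetric]
    by (intro bigoI[of _ 1] always_eventually allI) (simp, linarith)
  also have "(\<lambda>\<epsilon>. \<bar>a * ln (c / \<epsilon>\<^sup>2)\<bar> + 2) \<in> O[at_right 0](\<lambda>\<epsilon>. ln (1 / \<epsilon>))"
    using pos by real_asymp
  finally show ?thesis .
qed

text \<open>Choosing \<open>eta\<close> before all matrices expresses that the radius, and hence the
  constant in its logarithmic growth, depends only on the growth parameters and the extreme
  eigenvalues.\<close>

theorem theorem4:
  shows "\<exists>eta :: real \<Rightarrow> real \<Rightarrow> real \<Rightarrow> real \<Rightarrow> real \<Rightarrow> nat.
    (\<forall>\<gamma> \<delta> lmin lmax. \<gamma> > 0 \<longrightarrow> \<delta> > 0 \<longrightarrow> 0 < lmin \<longrightarrow> lmin \<le> lmax \<longrightarrow>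
       (\<lambda>\<epsilon>. real (eta \<gamma> \<delta> lmin lmax \<epsilon>)) \<in> O[at_right 0](\<lambda>\<epsilon>. ln (1 / \<epsilon>))) \<and>
    (\<forall>(n::nat) (m::nat) (F::real mat) (Q::real mat) (G::(nat \<times> nat) set)
       (\<gamma>::real) (\<delta>::real) (\<gamma>'::real) (\<delta>'::real) (\<epsilon>::real).
       n \<ge> 1 \<longrightarrow> F \<in> carrier_mat n m \<longrightarrow> Q = F * F\<^sup>T \<longrightarrow> positive_definite Q \<longrightarrow>
       G = supp_graph Q \<or> G = supp_graph (the (mat_inverse Q)) \<longrightarrow>
       \<gamma> > 0 \<longrightarrow> \<delta> > 0 \<longrightarrow> poly_volume_growth n G \<gamma> \<delta> \<longrightarrow>
       \<gamma>' > 0 \<longrightarrow> \<delta>' > 0 \<longrightarrow>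
       (\<forall>\<eta>::nat. \<eta> \<ge> 1 \<longrightarrow> real (max_boundary n G \<eta>) \<le> \<delta>' * real \<eta> powr \<gamma>') \<longrightarrow>
       \<epsilon> > 0 \<longrightarrow>
       (\<exists>D. eps_exact_diagram F \<epsilon> D \<and>
          real (num_nodes D) \<le> (real n + 1) *
            2 powr (\<delta>' * real (eta \<gamma> \<delta> (Min (spectrum Q)) (Max (spectrum Q)) \<epsilon>) powr \<gamma>')))"
\<comment> \<open>\<open>Suc\<close> matches the support radius \<open>Suc t\<close> of the local
  approximations, and makes the radius at least 1, as the boundary hypothesis requires.\<close>
proof (rule exI[of _ "\<lambda>\<gamma> \<delta> lmin lmax \<epsilon>. Suc (radius lmin lmax \<epsilon>)"], intro conjI allI impI)
  fix lmin lmax :: real assume "0 < lmin" "lmin \<le> lmax"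
  then show "(\<lambda>\<epsilon>. real (Suc (radius lmin lmax \<epsilon>))) \<in> O[at_right 0](\<lambda>\<epsilon>. ln (1 / \<epsilon>))"
    by (rule radius_bigo)
next
  fix n m :: nat and F Q :: "real mat" and G :: "(nat \<times> nat) set" and \<gamma>' \<delta>' \<epsilon> :: real
  assume n: "n \<ge> 1" and F: "F \<in> carrier_mat n m" and QF: "Q = F * F\<^sup>T" and pd: "positive_definite Q"
    and G: "G = supp_graph Q \<or> G = supp_graph (the (mat_inverse Q))"
    and \<delta>': "\<delta>' > 0" and eps: "\<epsilon> > 0"
    and boundary: "\<forall>\<eta>::nat. \<eta> \<ge> 1 \<longrightarrow> real (max_boundary n G \<eta>) \<le> \<delta>' * real \<eta> powr \<gamma>'"
  let ?lmin = "Min (spectrum Q)" and ?lmax = "Max (spectrum Q)"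
  define t where "t = radius ?lmin ?lmax \<epsilon>"
  have dim: "dim_row F = n" using F by simp
  have Q: "Q \<in> carrier_mat n n" unfolding QF using F by auto
  have bounds: "form_bounds n Q ?lmin ?lmax"
    by (rule positive_definite_form_bounds[OF Q pd n])
  obtain R where R: "mat_inverse Q = Some R" "R \<in> carrier_mat n n" "Q * R = 1\<^sub>m n" "R * Q = 1\<^sub>m n"
    by (rule positive_definite_mat_inverse[OF Q pd])
  have small: "4 * (?lmax ^ 3 / ?lmin\<^sup>2 * (1 - ?lmin / ?lmax) ^ t) \<le> \<epsilon>\<^sup>2"
    unfolding t_def using form_boundsD(3,5)[OF bounds] eps by (rule radius_error)
  have "\<exists>D. eps_exact_diagram F \<epsilon> D \<and>
      num_nodes D \<le> (\<Sum>k\<le>dim_row F. 2 ^ card (boundary n G (Suc t) k))"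
  proof (rule eps_exact_diagram_exists[OF eps])
    show "finite (boundary n G (Suc t) k)" for k
      unfolding boundary_def by simp
    show "boundary n G (Suc t) (dim_row F) = {}"
      unfolding boundary_def dim by simp
    show "norm_2_inf (H - H') \<le> \<epsilon>"
      if "residual_matrix F k P H" "residual_matrix F k P' H'"
        "P \<inter> boundary n G (Suc t) k = P' \<inter> boundary n G (Suc t) k" for k P P' H H'
      using residual_matrix_close[of F ?lmin ?lmax R G k P H P' H' t \<epsilon>] bounds R G that small eps
      unfolding QF[symmetric] dim by simp
  qed
  then obtain D where D: "eps_exact_diagram F \<epsilon> D"
    "num_nodes D \<le> (\<Sum>k\<le>n. 2 ^ card (boundary n G (Suc t) k))"
    unfolding dim by blast
  have card_le: "card (boundary n G (Suc t) k) \<le> max_boundary n G (Suc t)" if "k \<le> n" for k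
  proof (cases "k \<in> {1..<n}")
    case True
    then show ?thesis unfolding max_boundary_def by (intro Max_ge) auto
  next
    case False
    \<comment> \<open>The first and last layers are outside the range of the maximum, but one side
      of the cut is empty there.\<close>
    with that have "k = 0 \<or> k = n" by auto
    then have "boundary n G (Suc t) k = {}" unfolding boundary_def by auto
    then show ?thesis by simp
  qed
  have "real (num_nodes D) \<le> real (\<Sum>k\<le>n. 2 ^ card (boundary n G (Suc t) k))"
    using D(2) by (simp only: of_nat_le_iff)
  also have "\<dots> = (\<Sum>k\<le>n. 2 ^ card (boundary n G (Suc t) k))" by simp
  also have "\<dots> \<le> (\<Sum>k\<le>n. 2 powr (\<delta>' * real (Suc t) powr \<gamma>'))"
  proof (rule sum_mono)
    fix k assume "k \<in> {..n}"
    then have "real (card (boundary n G (Suc t) k)) \<le> \<delta>' * real (Suc t) powr \<gamma>'"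
      using card_le[of k] boundary[rule_format, of "Suc t"] by simp
    then show "2 ^ card (boundary n G (Suc t) k) \<le> (2 :: real) powr (\<delta>' * real (Suc t) powr \<gamma>')"
      by (simp add: powr_realpow[symmetric])
  qed
  also have "\<dots> = (real n + 1) * 2 powr (\<delta>' * real (Suc t) powr \<gamma>')" by simp
  finally show "\<exists>D. eps_exact_diagram F \<epsilon> D \<and> real (num_nodes D) \<le>
      (real n + 1) * 2 powr (\<delta>' * real (Suc (radius ?lmin ?lmax \<epsilon>)) powr \<gamma>')"
    using D(1) unfolding t_def by blast
qed

end
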